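(* Assume $d_i\ge 2$ for $i=1,\dots,l$. Then $\left(\mathcal{BM}_{\otimes}\left(\otimes_{i=1}^{l}\mathbb{R}^{d_{i}}\right),\log\delta_{\otimes}^{BM}\right)$ is a compact metric space.
   Context: Here $l$ and $d_1,\dots,d_l$ are positive integers. $\langle\cdot,\cdot\rangle$ is the standard scalar product on $\mathbb{R}^{d}$, and $\langle\cdot,\cdot\rangle_H$ is the scalar product on $\otimes_{i=1}^l\mathbb{R}^{d_i}$ determined by $\langle x^1\otimes\cdots\otimes x^l,y^1\otimes\cdots\otimes y^l\rangle_H=\prod_{i=1}^l\langle x^i,y^i\rangle$. In a Euclidean space $\mathbb{E}$, a convex body is a compact convex set with nonempty interior; it is $0$-symmetric if $P=-P$. The polar set of a nonempty $C\subset\mathbb{E}$ is $C^\circ=\{y\in\mathbb{E}:\sup_{x\in C}|\langle x,y\rangle_{\mathbb{E}}|\le 1\}$ (with $\langle\cdot,\cdot\rangle$ in $\mathbb{R}^{d_i}$ and $\langle\cdot,\cdot\rangle_H$ in the tensor product). For $0$-symmetric convex bodies $Q_i\subset\mathbb{R}^{d_i}$: $Q_1\otimes_\pi\cdots\otimes_\pi Q_l:=\mathrm{conv}\{x^1\otimes\cdots\otimes x^l:x^i\in Q_i,\ i=1,\dots,l\}$ and $Q_1\otimes_\epsilon\cdots\otimes_\epsilon Q_l:=(Q_1^\circ\otimes_\pi\cdots\otimes_\pi Q_l^\circ)^\circ$. $\mathcal{B}_\otimes(\otimes_{i=1}^l\mathbb{R}^{d_i})$ is the set of tensorial bodies in $\otimes_{i=1}^l\mathbb{R}^{d_i}$,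 i.e. the $0$-symmetric convex bodies $Q\subset\otimes_{i=1}^l\mathbb{R}^{d_i}$ for which there exist $0$-symmetric convex bodies $Q_i\subset\mathbb{R}^{d_i}$ with $Q_{1}\otimes_{\pi}\cdots\otimes_{\pi}Q_{l}\subseteq Q\subseteq Q_{1}\otimes_{\epsilon}\cdots\otimes_{\epsilon}Q_{l}$. $GL_\otimes(\otimes_{i=1}^l\mathbb{R}^{d_i})$ is the set of linear isomorphisms $T$ of $\otimes_{i=1}^l\mathbb{R}^{d_i}$ that preserve decomposable vectors, i.e. $T(x^1\otimes\cdots\otimes x^l)$ is a decomposable vector (of the form $y^1\otimes\cdots\otimes y^l$) for all $x^i\in\mathbb{R}^{d_i}$. The tensorial Banach-Mazur distance between tensorial bodies $P,Q$ is $$\delta_{\otimes}^{BM}(P,Q):=\inf\{\lambda\ge 1: Q\subseteq TP\subseteq\lambda Q\text{ for some }T\in GL_\otimes(\otimes_{i=1}^l\mathbb{R}^{d_i})\}.$$ The relation $P\sim Q$ iff $\delta_\otimes^{BM}(P,Q)=1$ is an equivalence relation on $\mathcal{B}_\otimes(\otimes_{i=1}^l\mathbb{R}^{d_i})$; $\mathcal{BM}_\otimes(\otimes_{i=1}^l\mathbb{R}^{d_i})$ is the set of its equivalence classes, and $\log\delta_\otimes^{BM}$ denotes the induced function on pairs of classes. *)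

theory Defs
  imports "HOL-Analysis.Analysis"
begin

text \<open>
  Encoding. The factors \<open>\<real>^{d\<^sub>i}\<close> have different dimensions, so they cannot all be types. The factor
  positions \<open>1, \<dots>, l\<close> are the elements of a finite type \<open>'l\<close>, and the \<open>i\<close>-th factor is the Euclidean
  space of real functions on a finite index set \<open>K i\<close> with \<open>card (K i) = d\<^sub>i\<close>. All \<open>K i\<close> are subsets of
  one finite type \<open>'n\<close>, and real functions on \<open>A\<close> are the vectors supported in \<open>A\<close>. Since \<open>'l\<close>, \<open>'n\<close> and
  \<open>K\<close> are arbitrary, every \<open>l \<ge> 1\<close> and every choice of \<open>d\<^sub>1, \<dots>, d\<^sub>l \<ge> 1\<close> occurs.
  Tensors are arrays indexed by the multi-indices \<open>s\<close> with \<open>s i \<in> K i\<close> for all \<open>i\<close>.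
\<close>

definition coord_space :: "'k::finite set \<Rightarrow> (real ^ 'k) set" where
  "coord_space A = {x. \<forall>k. k \<notin> A \<longrightarrow> x $ k = 0}"

definition elem_tensor :: "('l::finite \<Rightarrow> real ^ 'n::finite) \<Rightarrow> real ^ ('l \<Rightarrow> 'n)" where
  "elem_tensor x = (\<chi> s. \<Prod>i\<in>UNIV. x i $ s i)"

definition tensor_space :: "('l::finite \<Rightarrow> 'n::finite set) \<Rightarrow> (real ^ ('l \<Rightarrow> 'n)) set" where
  "tensor_space K = coord_space (Pi UNIV K)"

definition decomposables :: "('l::finite \<Rightarrow> 'n::finite set) \<Rightarrow> (real ^ ('l \<Rightarrow> 'n)) set" where
  "decomposables K = {elem_tensor x | x. \<forall>i. x i \<in> coord_space (K i)}"

text \<open>The next two lemmas identify \<^const>\<open>tensor_space\<close>, with the standard inner product of the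
  array space, as the tensor product of the factors with the scalar product
  \<open>\<langle>\<cdot>,\<cdot>\<rangle>\<^sub>H\<close>: it is spanned by the decomposable vectors, on which the defining formula holds.\<close>

lemma inner_elem_tensor:
  "elem_tensor x \<bullet> elem_tensor y = (\<Prod>i\<in>UNIV. x i \<bullet> y i)"
proof -
  have "(\<Prod>i\<in>UNIV. x i \<bullet> y i) = (\<Prod>i\<in>UNIV. \<Sum>k\<in>UNIV. x i $ k * y i $ k)"
    by (simp add: inner_vec_def)
  also have "\<dots> = (\<Sum>s\<in>PiE UNIV (\<lambda>_. UNIV). \<Prod>i\<in>UNIV. x i $ s i * y i $ s i)"
    by (rule prod_sum_PiE) auto
  also have "\<dots> = elem_tensor x \<bullet> elem_tensor y"
    by (simp add: inner_vec_def elem_tensor_def prod.distrib)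
  finally show ?thesis ..
qed

lemma subspace_coord_space: "subspace (coord_space A)"
  by (auto simp: subspace_def coord_space_def)

lemma span_decomposables:
  fixes K :: "'l::finite \<Rightarrow> 'n::finite set"
  shows "span (decomposables K) = tensor_space K"
proof
  have "elem_tensor x \<in> tensor_space K" if x: "\<forall>i. x i \<in> coord_space (K i)" for x
  proof -
    have "(\<Prod>i\<in>UNIV. x i $ s i) = 0" if "s \<notin> Pi UNIV K" for s
    proof -
      obtain i where "s i \<notin> K i"
        using \<open>s \<notin> Pi UNIV K\<close> by auto
      then have "x i $ s i = 0"
        using x by (auto simp: coord_space_def)
      then show ?thesis
        by (intro prod_zero) auto
    qed
    then show ?thesis
      by (simp add: tensor_space_def coord_space_def elem_tensor_def)
  qed
  then have "decomposables K \<subseteq> tensor_space K"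
    by (auto simp: decomposables_def)
  then show "span (decomposables K) \<subseteq> tensor_space K"
    by (intro span_minimal) (auto simp: tensor_space_def subspace_coord_space)
next
  have axis: "axis s 1 \<in> decomposables K" if "s \<in> Pi UNIV K" for s :: "'l \<Rightarrow> 'n"
  proof -
    have "axis s 1 = (elem_tensor (\<lambda>i. axis (s i) 1) :: real ^ ('l \<Rightarrow> 'n))"
    proof -
      have "(\<Prod>i\<in>UNIV. axis (s i) (1::real) $ t i) = 0" if "t \<noteq> s" for t
      proof -
        obtain i where "t i \<noteq> s i"
          using \<open>t \<noteq> s\<close> by (auto simp: fun_eq_iff)
        then have "axis (s i) (1::real) $ t i = 0"
          by (simp add: axis_def)
        then show ?thesis
          by (intro prod_zero) auto
      qed
      moreover have "(\<Prod>i\<in>UNIV. axis (s i) (1::real) $ s i) = 1"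
        by simp
      ultimately have "(axis s 1 :: real ^ ('l \<Rightarrow> 'n)) $ t = elem_tensor (\<lambda>i. axis (s i) 1) $ t" for t
        by (cases "t = s") (simp_all add: elem_tensor_def axis_def)
      then show ?thesis
        by (simp only: vec_eq_iff simp_thms)
    qed
    moreover have "axis (s i) 1 \<in> coord_space (K i)" for i
      using that by (auto simp: coord_space_def axis_def Pi_def)
    ultimately show ?thesis
      unfolding decomposables_def by blast
  qed
  show "tensor_space K \<subseteq> span (decomposables K)"
  proof
    fix z assume z: "z \<in> tensor_space K"
    have "z $ s *s axis s 1 \<in> span (decomposables K)" for s
    proof (cases "s \<in> Pi UNIV K")
      case True
      then show ?thesis
        unfolding scalar_mult_eq_scaleR by (intro span_scale span_base axis)
    next
      case False
      then have "z $ s = 0"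
        using z by (auto simp: tensor_space_def coord_space_def)
      then show ?thesis
        by (simp add: span_zero)
    qed
    then have "(\<Sum>s\<in>UNIV. z $ s *s axis s 1) \<in> span (decomposables K)"
      by (intro span_sum)
    then show "z \<in> span (decomposables K)"
      by (simp only: basis_expansion)
  qed
qed

text \<open>In the next two definitions the Euclidean space \<open>V\<close> is a subspace of the ambient type: the
  interior and the polar are those of \<open>V\<close>.\<close>

definition sym_convex_body :: "'a::euclidean_space set \<Rightarrow> 'a set \<Rightarrow> bool" where
  "sym_convex_body V Q \<longleftrightarrow>
     Q \<subseteq> V \<and> compact Q \<and> convex Q \<and> (top_of_set V) interior_of Q \<noteq> {} \<and> uminus ` Q = Q"

definition polar :: "'a::euclidean_space set \<Rightarrow> 'a set \<Rightarrow> 'a set" where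
  "polar V C = {y \<in> V. \<forall>x\<in>C. \<bar>x \<bullet> y\<bar> \<le> 1}"

definition proj_tensor :: "('l::finite \<Rightarrow> (real ^ 'n::finite) set) \<Rightarrow> (real ^ ('l \<Rightarrow> 'n)) set" where
  "proj_tensor Q = convex hull {elem_tensor x | x. \<forall>i. x i \<in> Q i}"

definition inj_tensor ::
  "('l::finite \<Rightarrow> 'n::finite set) \<Rightarrow> ('l \<Rightarrow> (real ^ 'n) set) \<Rightarrow> (real ^ ('l \<Rightarrow> 'n)) set" where
  "inj_tensor K Q = polar (tensor_space K) (proj_tensor (\<lambda>i. polar (coord_space (K i)) (Q i)))"

definition tensorial_bodies :: "('l::finite \<Rightarrow> 'n::finite set) \<Rightarrow> (real ^ ('l \<Rightarrow> 'n)) set set" where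
  "tensorial_bodies K = {P. sym_convex_body (tensor_space K) P \<and>
     (\<exists>Q. (\<forall>i. sym_convex_body (coord_space (K i)) (Q i)) \<and>
          proj_tensor Q \<subseteq> P \<and> P \<subseteq> inj_tensor K Q)}"

text \<open>A linear isomorphism of \<^term>\<open>tensor_space K\<close> is represented by any of its linear extensions
  to the ambient array space; only its values on \<^term>\<open>tensor_space K\<close> are ever used.\<close>

definition GL_tensor ::
  "('l::finite \<Rightarrow> 'n::finite set) \<Rightarrow> (real ^ ('l \<Rightarrow> 'n) \<Rightarrow> real ^ ('l \<Rightarrow> 'n)) set" where
  "GL_tensor K = {T. linear T \<and> bij_betw T (tensor_space K) (tensor_space K) \<and>
     T ` decomposables K \<subseteq> decomposables K}"

definition tensor_BM_dist ::
  "('l::finite \<Rightarrow> 'n::finite set) \<Rightarrow> (real ^ ('l \<Rightarrow> 'n)) set \<Rightarrow> (real ^ ('l \<Rightarrow> 'n)) set \<Rightarrow> real" where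
  "tensor_BM_dist K P Q =
     Inf {r. 1 \<le> r \<and> (\<exists>T\<in>GL_tensor K. Q \<subseteq> T ` P \<and> T ` P \<subseteq> (\<lambda>z. r *\<^sub>R z) ` Q)}"

definition tensor_BM_rel ::
  "('l::finite \<Rightarrow> 'n::finite set) \<Rightarrow> ((real ^ ('l \<Rightarrow> 'n)) set \<times> (real ^ ('l \<Rightarrow> 'n)) set) set" where
  "tensor_BM_rel K =
     {(P, Q). P \<in> tensorial_bodies K \<and> Q \<in> tensorial_bodies K \<and> tensor_BM_dist K P Q = 1}"

definition tensor_BM :: "('l::finite \<Rightarrow> 'n::finite set) \<Rightarrow> (real ^ ('l \<Rightarrow> 'n)) set set set" where
  "tensor_BM K = tensorial_bodies K // tensor_BM_rel K"

text \<open>The function induced by \<open>log \<delta>\<close> on pairs of classes: the common value on all representatives.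
  It is set to 0 off the set of classes because \<^locale>\<open>Metric_space\<close> requires a distance that is
  nonnegative and symmetric on the whole type.\<close>

definition log_tensor_BM_dist ::
  "('l::finite \<Rightarrow> 'n::finite set) \<Rightarrow> (real ^ ('l \<Rightarrow> 'n)) set set \<Rightarrow> (real ^ ('l \<Rightarrow> 'n)) set set \<Rightarrow> real" where
  "log_tensor_BM_dist K X Y =
     (if X \<in> tensor_BM K \<and> Y \<in> tensor_BM K
      then THE r. \<forall>P\<in>X. \<forall>Q\<in>Y. r = ln (tensor_BM_dist K P Q)
      else 0)"

end

theory Submission
  imports Defs "HOL-Complex_Analysis.Great_Picard"
begin

text \<open>
  Write \<open>\<delta>\<close> for the tensorial Banach-Mazur distance.

  \<^emph>\<open>The metric.\<close> Positive multiples of the identity preserve decomposable vectors, and each of two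
  bodies fits between multiples of the other, so \<open>\<delta>\<close> is finite. Composing maps gives the
  multiplicative triangle inequality. For symmetry, \<open>Q \<subseteq> T P \<subseteq> \<lambda> Q\<close> has to be turned into
  \<open>P \<subseteq> \<lambda> T\<^sup>-\<^sup>1 Q \<subseteq> \<lambda> P\<close>, and the point is that \<open>T\<^sup>-\<^sup>1\<close> again preserves decomposable vectors
  (\<open>GL_tensor_inverse\<close>). The decomposable tensors are the common zeros of quadratic equations (the \<open>2 \<times> 2\<close> minors of the
  flattenings), that is, \<open>z\<close> is decomposable iff \<open>z z\<^sup>T\<close> lies in the linear span \<open>W\<close> of all \<open>v v\<^sup>T\<close>
  with \<open>v\<close> decomposable. The map \<open>M \<mapsto> T M T\<^sup>T\<close> sends \<open>W\<close> injectively into itself, hence onto itself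
  because \<open>W\<close> has finite dimension, and so its inverse preserves \<open>W\<close> too. The quotient by \<open>\<delta> = 1\<close>
  with \<open>log \<delta>\<close> is then a metric space in the usual way.

  \<^emph>\<open>Compactness.\<close> Every tensorial body \<open>P\<close> with factors \<open>Q\<^sub>i\<close> is moved within its class to a
  normalised position. By Auerbach's lemma there are linear isomorphisms \<open>B\<^sub>i\<close> such that \<open>B\<^sub>i Q\<^sub>i\<close>
  contains the cross-polytope and is contained in the cube, and then \<open>(B\<^sub>1 \<otimes> \<cdots> \<otimes> B\<^sub>l) P\<close> lies
  between the cross-polytope and the cube of the tensor space (\<open>normalisation\<close>). Bodies between two
  fixed balls form a sequentially compact family (\<open>body_family_selection\<close>, Blaschke's selection
  theorem). Applied to the factors and to the bodies, it gives a subsequence along which both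
  converge; the inclusions that define tensorial bodies survive in the limit
  (\<open>tensorial_pair_limit\<close>). Convergence is expressed by \<open>P\<^sub>n \<subseteq> (1 + e) P\<close> and \<open>P \<subseteq> (1 + e) P\<^sub>n\<close>,
  which bounds \<open>\<delta>(P\<^sub>n, P)\<close> by \<open>(1 + e)\<^sup>2\<close>.
\<close>

section \<open>Symmetric convex bodies of a subspace\<close>

text \<open>If a ball around \<open>x\<close> lies in \<open>Q\<close>, then so does the one around \<open>- x\<close>, and the ball around the
  origin consists of midpoints of the two.\<close>

lemma sym_convex_body_ball:
  fixes V :: "'a::euclidean_space set"
  assumes V: "subspace V" and Q: "sym_convex_body V Q"
  obtains r where "0 < r" "cball 0 r \<inter> V \<subseteq> Q"
proof -
  obtain x where "x \<in> (top_of_set V) interior_of Q"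
    using Q by (auto simp: sym_convex_body_def)
  then obtain U where U: "open U" "x \<in> U" "x \<in> V" "U \<inter> V \<subseteq> Q"
    by (force simp: interior_of_def openin_open)
  obtain r where r: "0 < r" "cball x r \<subseteq> U"
    using U open_contains_cball by blast
  have conv: "convex Q" and sym: "uminus ` Q = Q"
    using Q by (auto simp: sym_convex_body_def)
  have "z \<in> Q" if z: "z \<in> cball 0 r" "z \<in> V" for z
  proof -
    have "x + z \<in> Q" "x - z \<in> Q"
      using U z V by (auto intro!: subsetD[OF U(4)] subsetD[OF r(2)] subspace_add[OF V] subspace_diff[OF V]
          simp: dist_norm)
    then have "x + z \<in> Q" "- (x - z) \<in> Q"
      using sym by blast+
    then have "(1/2) *\<^sub>R (x + z) + (1/2) *\<^sub>R (- (x - z)) \<in> Q"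
      by (intro convexD[OF conv]) auto
    moreover have "(1/2) *\<^sub>R (x + z) + (1/2) *\<^sub>R (- (x - z)) = z"
      by (simp add: algebra_simps flip: scaleR_add_left)
    ultimately show ?thesis by simp
  qed
  then show ?thesis
    using r by (intro that[of r]) auto
qed

lemma sym_convex_bodyI:
  fixes V :: "'a::euclidean_space set"
  assumes "subspace V" "Q \<subseteq> V" "compact Q" "convex Q" "\<And>x. x \<in> Q \<Longrightarrow> - x \<in> Q"
    and r: "0 < r" "cball 0 r \<inter> V \<subseteq> Q"
  shows "sym_convex_body V Q"
proof -
  have "openin (top_of_set V) (V \<inter> ball 0 r)" "V \<inter> ball 0 r \<subseteq> Q"
    using r(2) by (auto intro: openin_open_Int)
  then have "V \<inter> ball 0 r \<subseteq> (top_of_set V) interior_of Q"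
    by (simp add: interior_of_maximal)
  then have "0 \<in> (top_of_set V) interior_of Q"
    using r(1) subspace_0[OF assms(1)] by auto
  moreover have "uminus ` Q = Q"
    using assms(5) by force
  ultimately show ?thesis
    using assms by (auto simp: sym_convex_body_def)
qed

lemma sym_convex_bodyD:
  assumes "sym_convex_body V Q"
  shows "Q \<subseteq> V" "compact Q" "closed Q" "convex Q" "x \<in> Q \<Longrightarrow> - x \<in> Q"
  using assms by (auto simp: sym_convex_body_def compact_imp_closed)

lemma sym_convex_body_bounds:
  fixes V :: "'a::euclidean_space set"
  assumes V: "subspace V" and Q: "sym_convex_body V Q"
  obtains r R where "0 < r" "0 < R" "cball 0 r \<inter> V \<subseteq> Q" "Q \<subseteq> cball 0 R"
proof -
  obtain r where "0 < r" "cball 0 r \<inter> V \<subseteq> Q"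
    using sym_convex_body_ball[OF assms] .
  moreover obtain R where "0 < R" "Q \<subseteq> cball 0 R"
    using sym_convex_bodyD(2)[OF Q] by (metis bounded_pos compact_imp_bounded mem_cball_0 subsetI)
  ultimately show ?thesis
    using that by blast
qed

lemma mem_scaleR_image_iff: "0 < t \<Longrightarrow> z \<in> (*\<^sub>R) t ` P \<longleftrightarrow> inverse t *\<^sub>R z \<in> P"
  for z :: "'a::real_vector"
  by (force simp: image_iff)

text \<open>On unbounded or empty sets the supremum is a default value; it is only used for nonempty bounded
  sets.\<close>

definition support :: "'a::euclidean_space set \<Rightarrow> 'a \<Rightarrow> real" where
  "support P y = (SUP x\<in>P. x \<bullet> y)"

lemma support_upper:
  assumes "P \<subseteq> cball 0 R" "x \<in> P"
  shows "x \<bullet> y \<le> support P y"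
proof -
  have "x' \<bullet> y \<le> R * norm y" if "x' \<in> P" for x'
    using assms(1) that
    by (intro order_trans[OF norm_cauchy_schwarz] mult_right_mono) auto
  then show ?thesis
    unfolding support_def using assms(2) by (intro cSUP_upper) (auto intro!: bdd_aboveI)
qed

lemma support_le:
  assumes "P \<noteq> {}" "\<And>x. x \<in> P \<Longrightarrow> x \<bullet> y \<le> c"
  shows "support P y \<le> c"
  unfolding support_def using assms by (intro cSUP_least)

lemma support_lipschitz:
  assumes P: "P \<noteq> {}" "P \<subseteq> cball 0 R"
  shows "\<bar>support P x - support P y\<bar> \<le> R * norm (x - y)"
proof -
  have *: "support P x \<le> support P y + R * norm (x - y)" for x y
  proof (rule support_le[OF P(1)])
    fix z assume z: "z \<in> P"
    have "z \<bullet> x = z \<bullet> y + z \<bullet> (x - y)"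
      by (simp add: algebra_simps)
    also have "z \<bullet> (x - y) \<le> R * norm (x - y)"
      using P z by (intro order_trans[OF norm_cauchy_schwarz] mult_right_mono) auto
    also have "z \<bullet> y \<le> support P y"
      using support_upper[OF P(2) z] .
    finally show "z \<bullet> x \<le> support P y + R * norm (x - y)" by simp
  qed
  show ?thesis
    using *[of x y] *[of y x] by (simp add: norm_minus_commute)
qed

text \<open>The hyperplane theorem separates in the ambient space. Replacing the normal vector by its
  orthogonal projection to \<open>V\<close> changes no inner product with a vector of \<open>V\<close>, so unit directions of
  \<open>V\<close> suffice.\<close>

lemma sym_convex_body_mem_if_le_support:
  fixes V :: "'a::euclidean_space set"
  assumes V: "subspace V" and P: "sym_convex_body V P" and z: "z \<in> V"
    and le: "\<And>y. y \<in> V \<Longrightarrow> norm y = 1 \<Longrightarrow> z \<bullet> y \<le> support P y"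
  shows "z \<in> P"
proof (rule ccontr)
  assume "z \<notin> P"
  obtain r where r: "0 < r" "cball 0 r \<inter> V \<subseteq> P"
    using sym_convex_body_ball[OF V P] .
  then have "0 \<in> P"
    using subspace_0[OF V] by auto
  obtain a b where ab: "a \<bullet> z < b" "\<And>x. x \<in> P \<Longrightarrow> b < a \<bullet> x"
    using separating_hyperplane_closed_point[OF sym_convex_bodyD(4)[OF P] sym_convex_bodyD(3)[OF P] \<open>z \<notin> P\<close>] by auto
  obtain a' a'' where a: "a' \<in> V" "\<And>w. w \<in> V \<Longrightarrow> orthogonal a'' w" "a = a' + a''"
    using orthogonal_subspace_decomp_exists[of V a] V by (metis span_eq_iff)
  have inner: "a \<bullet> w = a' \<bullet> w" if "w \<in> V" for w
    using a that by (simp add: inner_add_left orthogonal_def)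
  define y where "y = - (inverse (norm a') *\<^sub>R a')"
  have "b < 0"
    using ab(2)[OF \<open>0 \<in> P\<close>] by simp
  then have "a' \<noteq> 0"
    using ab(1) inner[OF z] by auto
  then have y: "y \<in> V" "norm y = 1"
    using a V unfolding y_def by (auto intro!: subspace_neg subspace_mul)
  have scale: "w \<bullet> y = - (a \<bullet> w / norm a')" if "w \<in> V" for w
    using inner[OF that] by (simp add: y_def inner_commute field_simps)
  have "support P y \<le> - (b / norm a')"
  proof (rule support_le)
    fix x assume x: "x \<in> P"
    then have "x \<in> V"
      using sym_convex_bodyD(1)[OF P] by auto
    then show "x \<bullet> y \<le> - (b / norm a')"
      using ab(2)[OF x] \<open>a' \<noteq> 0\<close> by (simp add: scale divide_right_mono)
  qed (use \<open>0 \<in> P\<close> in auto)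
  moreover have "z \<bullet> y > - (b / norm a')"
    using ab(1) \<open>a' \<noteq> 0\<close> by (simp add: scale[OF z] divide_strict_right_mono)
  ultimately show False
    using le[OF y] by simp
qed

text \<open>Blaschke's selection theorem, in a form where one subsequence serves a finite family of bodies.
  The support functions are uniformly bounded and have a common Lipschitz constant, so by
  Arzela-Ascoli a subsequence converges uniformly on the unit ball, simultaneously for all \<open>i\<close> when
  they are combined into one vector-valued function. The limit body is the intersection of the slabs
  given by the limit \<open>g\<close>. Since \<open>g \<ge> r\<close> on unit vectors, a uniform error \<open>r e\<close> of the support
  functions is at most the factor \<open>1 + e\<close>.\<close>

theorem body_family_selection:
  fixes V :: "'l::finite \<Rightarrow> 'a::euclidean_space set" and P :: "nat \<Rightarrow> 'l \<Rightarrow> 'a set"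
  assumes V: "\<And>i. subspace (V i)" and P: "\<And>n i. sym_convex_body (V i) (P n i)"
    and r: "0 < r" "\<And>n i. cball 0 r \<inter> V i \<subseteq> P n i" and R: "\<And>n i. P n i \<subseteq> cball 0 R"
  obtains k L where "strict_mono (k :: nat \<Rightarrow> nat)" "\<forall>i. sym_convex_body (V i) (L i)"
    "\<forall>e>0. \<forall>\<^sub>F n in sequentially. \<forall>i.
       P (k n) i \<subseteq> (*\<^sub>R) (1 + e) ` L i \<and> L i \<subseteq> (*\<^sub>R) (1 + e) ` P (k n) i"
proof -
  define S :: "'a set" where "S = cball 0 1"
  define F :: "nat \<Rightarrow> 'a \<Rightarrow> real ^ 'l" where "F n y = (\<chi> i. support (P n i) y)" for n y
  have zero: "0 \<in> P n i" for n i
    using r(1) subspace_0[OF V] by (intro subsetD[OF r(2)]) auto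
  then have ne: "P n i \<noteq> {}" for n i by blast
  have "0 \<le> R"
    using R zero by (metis mem_cball_0 norm_zero subsetD)
  have lip: "norm (F n x - F n y) \<le> (CARD('l) * R) * norm (x - y)" for n x y
  proof -
    have "norm (F n x - F n y) \<le> (\<Sum>i\<in>UNIV. \<bar>(F n x - F n y) $ i\<bar>)"
      by (rule norm_le_l1_cart)
    also have "\<dots> \<le> (\<Sum>i\<in>(UNIV::'l set). R * norm (x - y))"
      by (intro sum_mono) (simp add: F_def support_lipschitz[OF ne R])
    finally show ?thesis by simp
  qed
  have F0: "F n 0 = 0" for n
    using ne by (simp add: F_def support_def vec_eq_iff)
  obtain g k where k: "strict_mono (k :: nat \<Rightarrow> nat)" and
    g: "\<And>e. 0 < e \<Longrightarrow> \<exists>N. \<forall>n x. n \<ge> N \<and> x \<in> S \<longrightarrow> norm (F (k n) x - g x) < e"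
  proof (rule Arzela_Ascoli[of S F "CARD('l) * R"])
    show "compact S" by (simp add: S_def)
    show "norm (F n x) \<le> CARD('l) * R" if "x \<in> S" for n x
    proof -
      have "norm (F n x) \<le> (CARD('l) * R) * norm x"
        using lip[of n x 0] by (simp add: F0)
      also have "\<dots> \<le> (CARD('l) * R) * 1"
        using that \<open>0 \<le> R\<close> by (intro mult_left_mono) (auto simp: S_def)
      finally show ?thesis by simp
    qed
    show "\<exists>d. 0 < d \<and> (\<forall>n y. y \<in> S \<and> norm (x - y) < d \<longrightarrow> norm (F n x - F n y) < e)"
      if "x \<in> S" "0 < e" for x e
    proof (intro exI conjI allI impI)
      have pos: "0 < CARD('l) * R + 1"
        using \<open>0 \<le> R\<close> by (simp add: add_nonneg_pos)
      then show "0 < e / (CARD('l) * R + 1)"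
        using \<open>0 < e\<close> by simp
      fix n y assume "y \<in> S \<and> norm (x - y) < e / (CARD('l) * R + 1)"
      then have "norm (x - y) * (CARD('l) * R + 1) < e"
        using pos by (simp add: pos_less_divide_eq)
      moreover have "(CARD('l) * R) * norm (x - y) \<le> norm (x - y) * (CARD('l) * R + 1)"
        by (simp add: algebra_simps)
      ultimately show "norm (F n x - F n y) < e"
        using lip[of n x y] by linarith
    qed
  qed (use that in auto)
  define L where "L i = {z \<in> V i. \<forall>y\<in>V i. norm y = 1 \<longrightarrow> \<bar>z \<bullet> y\<bar> \<le> g y $ i}" for i
  have close: "\<forall>\<^sub>F n in sequentially. \<forall>i y. norm y = 1 \<longrightarrow> \<bar>support (P (k n) i) y - g y $ i\<bar> < e"
    if e: "0 < e" for e
  proof -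
    obtain N where N: "\<And>n x. n \<ge> N \<Longrightarrow> x \<in> S \<Longrightarrow> norm (F (k n) x - g x) < e"
      using g[OF e] by blast
    show ?thesis
      unfolding eventually_sequentially
    proof (intro exI allI impI)
      fix n i and y :: 'a assume "N \<le> n" "norm y = 1"
      then have "norm (F (k n) y - g y) < e"
        by (intro N) (auto simp: S_def)
      moreover have "\<bar>(F (k n) y - g y) $ i\<bar> \<le> norm (F (k n) y - g y)"
        by (rule component_le_norm_cart)
      ultimately show "\<bar>support (P (k n) i) y - g y $ i\<bar> < e"
        by (simp add: F_def)
    qed
  qed
  have lim: "(\<lambda>n. support (P (k n) i) y) \<longlonglongrightarrow> g y $ i" if "norm y = 1" for y i
    using close that unfolding tendsto_iff dist_real_def
    by (force elim: eventually_mono)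
  have support_ge: "r \<le> support (P n i) y" if "y \<in> V i" "norm y = 1" for n i y
  proof -
    have "r *\<^sub>R y \<in> P n i"
      using r(1) that V by (intro subsetD[OF r(2)]) (auto intro: subspace_mul)
    then show ?thesis
      using support_upper[OF R, of "r *\<^sub>R y" n i y] that by (simp add: dot_square_norm)
  qed
  have support_bound: "support (P n i) y \<le> R" if "norm y = 1" for n i y
    using support_lipschitz[OF ne R, of n i y 0] that F0[of n] by (simp add: F_def vec_eq_iff)
  have g_ge: "r \<le> g y $ i" if "y \<in> V i" "norm y = 1" for i y
    using LIMSEQ_le_const[OF lim[OF that(2)]] support_ge[OF that] by blast
  have g_le: "g y $ i \<le> R" if "norm y = 1" for i y
    using LIMSEQ_le_const2[OF lim[OF that]] support_bound[OF that] by blast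
  have abs_support: "\<bar>x \<bullet> y\<bar> \<le> support (P n i) y" if "x \<in> P n i" for x y n i
    using support_upper[OF R that, of y] support_upper[OF R sym_convex_bodyD(5)[OF P that], of y] by auto
  have "sym_convex_body (V i) (L i)" for i
  proof (rule sym_convex_bodyI[OF V _ _ _ _ r(1)])
    show "L i \<subseteq> V i" by (auto simp: L_def)
    have eq: "L i = V i \<inter> (\<Inter>y\<in>{y\<in>V i. norm y = 1}. {z. z \<bullet> y \<le> g y $ i} \<inter> {z. z \<bullet> y \<ge> - (g y $ i)})"
      by (force simp: L_def abs_le_iff)
    have half: "{z. z \<bullet> y \<le> c} = {z. y \<bullet> z \<le> c}" "{z. z \<bullet> y \<ge> c} = {z. y \<bullet> z \<ge> c}" for y :: 'a and c
      by (auto simp: inner_commute)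
    have "closed (L i)"
      unfolding eq half
      by (intro closed_Int closed_INT ballI closed_halfspace_le closed_halfspace_ge closed_subspace V)
    moreover have "norm z \<le> R" if "z \<in> L i" for z
    proof (cases "z = 0")
      case False
      then have "inverse (norm z) *\<^sub>R z \<in> V i" "norm (inverse (norm z) *\<^sub>R z) = 1"
        using that V by (auto simp: L_def intro: subspace_mul)
      then have "\<bar>z \<bullet> (inverse (norm z) *\<^sub>R z)\<bar> \<le> g (inverse (norm z) *\<^sub>R z) $ i"
        using that unfolding L_def by blast
      also have "\<dots> \<le> R"
        using False by (intro g_le) auto
      finally show ?thesis
        using False by (simp add: dot_square_norm power2_eq_square flip: mult.assoc)
    qed (use \<open>0 \<le> R\<close> in auto)
    ultimately show "compact (L i)"
      by (auto simp: compact_eq_bounded_closed bounded_iff)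
    show "convex (L i)"
      unfolding eq half
      by (intro convex_Int convex_INT convex_halfspace_le convex_halfspace_ge subspace_imp_convex V)
    show "- x \<in> L i" if "x \<in> L i" for x
      using that V by (auto simp: L_def intro: subspace_neg)
    show "cball 0 r \<inter> V i \<subseteq> L i"
    proof
      fix z assume z: "z \<in> cball 0 r \<inter> V i"
      then have "\<bar>z \<bullet> y\<bar> \<le> g y $ i" if "y \<in> V i" "norm y = 1" for y
        using Cauchy_Schwarz_ineq2[of z y] that g_ge[OF that] by simp
      then show "z \<in> L i"
        using z by (auto simp: L_def)
    qed
  qed
  moreover have "\<forall>\<^sub>F n in sequentially. \<forall>i.
      P (k n) i \<subseteq> (*\<^sub>R) (1 + e) ` L i \<and> L i \<subseteq> (*\<^sub>R) (1 + e) ` P (k n) i" if e: "0 < e" for e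
  proof -
    have "0 < r * e"
      using r(1) e by simp
    then show ?thesis
    proof (rule eventually_mono[OF close], intro allI conjI subsetI)
      fix n i z
      assume close: "\<forall>i y. norm y = 1 \<longrightarrow> \<bar>support (P (k n) i) y - g y $ i\<bar> < r * e"
      {
        assume z: "z \<in> P (k n) i"
        then have "z \<in> V i"
          using sym_convex_bodyD(1)[OF P] by auto
        have "\<bar>z \<bullet> y\<bar> \<le> (1 + e) * g y $ i" if y: "y \<in> V i" "norm y = 1" for y
        proof -
          have "\<bar>support (P (k n) i) y - g y $ i\<bar> < r * e"
            using close y by blast
          then have "\<bar>z \<bullet> y\<bar> \<le> g y $ i + r * e"
            using abs_support[OF z, of y] by linarith
          also have "r * e \<le> g y $ i * e"
            using g_ge[OF y] e by simp
          finally show ?thesis by (simp add: algebra_simps)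
        qed
        then show "z \<in> (*\<^sub>R) (1 + e) ` L i"
          using \<open>z \<in> V i\<close> e V
          by (auto simp: mem_scaleR_image_iff L_def abs_mult intro!: subspace_mul)
             (simp add: field_simps)
      next
        assume z: "z \<in> L i"
        have "inverse (1 + e) *\<^sub>R z \<in> P (k n) i"
        proof (rule sym_convex_body_mem_if_le_support[OF V P])
          show "inverse (1 + e) *\<^sub>R z \<in> V i"
            using z V by (auto simp: L_def intro!: subspace_mul)
          fix y assume y: "y \<in> V i" "norm y = 1"
          have "\<bar>support (P (k n) i) y - g y $ i\<bar> < r * e"
            using close y by blast
          moreover have "\<bar>z \<bullet> y\<bar> \<le> g y $ i"
            using z y by (simp add: L_def)
          ultimately have "z \<bullet> y \<le> support (P (k n) i) y + r * e"
            by linarith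
          also have "r * e \<le> support (P (k n) i) y * e"
            using support_ge[OF y] e by simp
          finally show "(inverse (1 + e) *\<^sub>R z) \<bullet> y \<le> support (P (k n) i) y"
            using e by (simp add: field_simps)
        qed
        then show "z \<in> (*\<^sub>R) (1 + e) ` P (k n) i"
          using e by (simp add: mem_scaleR_image_iff)
      }
    qed
  qed
  ultimately show ?thesis
    using k that by blast
qed

section \<open>Automorphisms preserving decomposable tensors\<close>

lemma subspace_tensor_space: "subspace (tensor_space K)"
  by (simp add: tensor_space_def subspace_coord_space)

lemma decomposables_subset: "decomposables K \<subseteq> tensor_space K"
  using span_superset[of "decomposables K"] by (simp add: span_decomposables)

lemma elem_tensor_scale:
  "elem_tensor (\<lambda>i. c *\<^sub>R x i) = c ^ CARD('l) *\<^sub>R elem_tensor (x :: 'l::finite \<Rightarrow> real ^ 'n::finite)"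
  by (simp add: elem_tensor_def vec_eq_iff prod.distrib)

text \<open>A scalar can be absorbed into any one factor.\<close>

lemma scale_elem_tensor:
  fixes x :: "'l::finite \<Rightarrow> real ^ 'n::finite"
  shows "c *\<^sub>R elem_tensor x = elem_tensor (x(i := c *\<^sub>R x i))"
proof -
  have "(\<Prod>j\<in>UNIV. (x(i := c *\<^sub>R x i)) j $ s j) = c * (\<Prod>j\<in>UNIV. x j $ s j)" for s
  proof -
    have "(\<Prod>j\<in>UNIV. (x(i := c *\<^sub>R x i)) j $ s j) =
        (c * x i $ s i) * (\<Prod>j\<in>UNIV - {i}. (x(i := c *\<^sub>R x i)) j $ s j)"
      by (subst prod.remove[of UNIV i]) auto
    also have "(\<Prod>j\<in>UNIV - {i}. (x(i := c *\<^sub>R x i)) j $ s j) = (\<Prod>j\<in>UNIV - {i}. x j $ s j)"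
      by (intro prod.cong) auto
    also have "(c * x i $ s i) * \<dots> = c * (\<Prod>j\<in>UNIV. x j $ s j)"
      by (simp add: prod.remove[of UNIV i])
    finally show ?thesis .
  qed
  then show ?thesis
    by (simp add: elem_tensor_def vec_eq_iff)
qed

lemma decomposables_scale: "z \<in> decomposables K \<Longrightarrow> c *\<^sub>R z \<in> decomposables K"
proof -
  assume "z \<in> decomposables K"
  then obtain x where x: "\<And>i. x i \<in> coord_space (K i)" "z = elem_tensor x"
    by (auto simp: decomposables_def)
  fix i
  have "c *\<^sub>R z = elem_tensor (x(i := c *\<^sub>R x i))"
    unfolding x(2) by (rule scale_elem_tensor)
  moreover have "(x(i := c *\<^sub>R x i)) j \<in> coord_space (K j)" for j
    using x(1) by (auto intro: subspace_mul subspace_coord_space)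
  ultimately show ?thesis
    unfolding decomposables_def by blast
qed

text \<open>The equations of the Segre variety: exchanging the \<open>i\<close>-th entries of two multi-indices does not
  change the product of the two coordinates. Conversely, if \<open>z $ s \<noteq> 0\<close>, the line of \<open>z\<close> through \<open>s\<close>
  in direction \<open>i\<close> serves as the \<open>i\<close>-th factor: moving from \<open>s\<close> to \<open>t\<close> one entry at a time
  expresses \<open>z $ t\<close> by entries of these factors and a power of \<open>z $ s\<close>.\<close>

lemma decomposable_iff_exchange:
  fixes K :: "'l::finite \<Rightarrow> 'n::finite set"
  shows "z \<in> decomposables K \<longleftrightarrow> z \<in> tensor_space K \<and>
    (\<forall>s t i. z $ s * z $ t = z $ s(i := t i) * z $ t(i := s i))"
proof
  assume z: "z \<in> decomposables K"
  then obtain x where x: "z = elem_tensor x"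
    by (auto simp: decomposables_def)
  have "z $ s * z $ t = z $ s(i := t i) * z $ t(i := s i)" for s t i
    unfolding x elem_tensor_def vec_lambda_beta prod.distrib[symmetric]
    by (intro prod.cong) auto
  then show "z \<in> tensor_space K \<and> (\<forall>s t i. z $ s * z $ t = z $ s(i := t i) * z $ t(i := s i))"
    using z decomposables_subset by blast
next
  assume R: "z \<in> tensor_space K \<and> (\<forall>s t i. z $ s * z $ t = z $ s(i := t i) * z $ t(i := s i))"
  show "z \<in> decomposables K"
  proof (cases "z = 0")
    case True
    have "z = elem_tensor (\<lambda>i. 0)"
      using True by (simp add: elem_tensor_def vec_eq_iff)
    then show ?thesis
      unfolding decomposables_def by (auto intro: subspace_0 subspace_coord_space)
  next
    case False
    then obtain s where s: "z $ s \<noteq> 0"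
      by (auto simp: vec_eq_iff)
    define y :: "'l \<Rightarrow> real ^ 'n" where "y i = (\<chi> k. z $ s(i := k))" for i
    \<comment> \<open>The multi-index that follows \<open>t\<close> on \<open>A\<close> and \<open>s\<close> elsewhere.\<close>
    define u where "u A t = (\<lambda>j. if j \<in> A then t j else s j)" for A :: "'l set" and t :: "'l \<Rightarrow> 'n"
    have prod: "z $ u A t * z $ s ^ card A = z $ s * (\<Prod>i\<in>A. y i $ t i)" for A t
      using finite[of A]
    proof (induction A rule: finite_induct)
      case empty
      then show ?case by (simp add: u_def)
    next
      case (insert i A)
      have 1: "(u (insert i A) t)(i := s i) = u A t"
        using insert.hyps by (auto simp: u_def fun_eq_iff)
      have 2: "u (insert i A) t i = t i"
        by (simp add: u_def)
      have "z $ u (insert i A) t * z $ s = z $ (u (insert i A) t)(i := s i) * z $ s(i := u (insert i A) t i)"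
        using R by blast
      then have "z $ u (insert i A) t * z $ s = z $ u A t * y i $ t i"
        unfolding 1 2 by (simp add: y_def)
      then have "z $ u (insert i A) t * z $ s ^ card (insert i A) = (z $ u A t * z $ s ^ card A) * y i $ t i"
        using insert.hyps by (simp add: algebra_simps)
      then show ?case
        using insert by (simp add: mult_ac)
    qed
    have "y i \<in> coord_space (K i)" for i
      unfolding coord_space_def
    proof (intro CollectI allI impI)
      fix k assume "k \<notin> K i"
      then have "s(i := k) \<notin> Pi UNIV K"
        by (metis PiE UNIV_I fun_upd_same)
      then show "y i $ k = 0"
        using R by (simp add: y_def tensor_space_def coord_space_def)
    qed
    then have D: "elem_tensor y \<in> decomposables K"
      unfolding decomposables_def by blast
    have "u UNIV t = t" for t
      by (simp add: u_def)
    then have "z $ t * z $ s ^ CARD('l) = z $ s * (\<Prod>i\<in>UNIV. y i $ t i)" for t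
      using prod[of UNIV t] by simp
    then have "z = (z $ s / z $ s ^ CARD('l)) *\<^sub>R elem_tensor y"
      using s by (simp add: vec_eq_iff elem_tensor_def field_simps)
    then show ?thesis
      using decomposables_scale[OF D] by metis
  qed
qed

definition outer_square :: "real ^ 'k::finite \<Rightarrow> real ^ 'k ^ 'k" where
  "outer_square z = (\<chi> s t. z $ s * z $ t)"

lemma outer_square_matrix_mult:
  "outer_square (A *v z) = A ** outer_square z ** transpose A"
proof -
  have "(\<Sum>p\<in>UNIV. A $ s $ p * z $ p) * (\<Sum>q\<in>UNIV. A $ t $ q * z $ q) =
      (\<Sum>q\<in>UNIV. (\<Sum>p\<in>UNIV. A $ s $ p * (z $ p * z $ q)) * A $ t $ q)" for s t
    by (simp add: sum_distrib_left sum_distrib_right mult_ac)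
  then show ?thesis
    by (simp add: outer_square_def matrix_matrix_mult_def matrix_vector_mult_def transpose_def vec_eq_iff)
qed

text \<open>The exchange equations are linear in \<^term>\<open>outer_square z\<close>, so they extend from the squares of
  decomposable tensors to their span.\<close>

lemma decomposable_iff_outer_square:
  assumes z: "z \<in> tensor_space K"
  shows "z \<in> decomposables K \<longleftrightarrow> outer_square z \<in> span (outer_square ` decomposables K)"
proof
  assume "outer_square z \<in> span (outer_square ` decomposables K)"
  then have "outer_square z $ s $ t = outer_square z $ s(i := t i) $ t(i := s i)" for s t i
  proof (induction rule: span_induct)
    show "subspace {M :: real ^ ('a \<Rightarrow> 'b) ^ ('a \<Rightarrow> 'b). M $ s $ t = M $ s(i := t i) $ t(i := s i)}"
      by (auto simp: subspace_def)
  next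
    fix M assume "M \<in> outer_square ` decomposables K"
    then show "M $ s $ t = M $ s(i := t i) $ t(i := s i)"
      using decomposable_iff_exchange[of _ K] by (auto simp: outer_square_def)
  qed
  then show "z \<in> decomposables K"
    using z by (simp add: decomposable_iff_exchange outer_square_def)
qed (auto intro: span_base)

text \<open>Surjectivity is automatic: decomposables span the tensor space, so \<open>T\<close> maps it into itself, and
  dimensions agree.\<close>

lemma GL_tensorI:
  assumes "linear T" "inj_on T (tensor_space K)" "T ` decomposables K \<subseteq> decomposables K"
  shows "T \<in> GL_tensor K"
proof -
  have "T ` tensor_space K = span (T ` decomposables K)"
    using linear_span_image[OF assms(1), of "decomposables K"] by (simp add: span_decomposables)
  also have "\<dots> \<subseteq> tensor_space K"
    using assms(3) span_mono span_decomposables by metis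
  finally have "T ` tensor_space K \<subseteq> tensor_space K" .
  moreover have "dim (T ` tensor_space K) = dim (tensor_space K)"
    using assms(2) subspace_tensor_space[of K] by (intro dim_image_eq assms(1)) (metis span_eq_iff)
  ultimately have "T ` tensor_space K = tensor_space K"
    by (intro subspace_dim_equal linear_subspace_image subspace_tensor_space assms(1)) auto
  then show ?thesis
    using assms by (simp add: GL_tensor_def bij_betw_def)
qed

lemma GL_tensorD:
  assumes "T \<in> GL_tensor K"
  shows "linear T" "inj_on T (tensor_space K)" "T ` tensor_space K = tensor_space K"
    "T ` decomposables K \<subseteq> decomposables K"
  using assms by (auto simp: GL_tensor_def bij_betw_def)

text \<open>\<open>T2\<close> and \<open>S2\<close> are the actions of \<open>T\<close> and of its inverse on the span \<open>W\<close> of the outer squares of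
  decomposables. As \<open>T2\<close> is injective on \<open>W\<close> and maps it into itself, it is onto; so \<open>S2\<close> preserves
  \<open>W\<close>, and membership of the outer square in \<open>W\<close> characterises decomposability.\<close>

theorem GL_tensor_inverse:
  fixes K :: "'l::finite \<Rightarrow> 'n::finite set"
  assumes T: "T \<in> GL_tensor K"
  obtains S where "S \<in> GL_tensor K" "\<And>z. z \<in> tensor_space K \<Longrightarrow> S (T z) = z"
    "\<And>z. z \<in> tensor_space K \<Longrightarrow> T (S z) = z"
proof -
  let ?V = "tensor_space K" and ?D = "decomposables K"
  define W where "W = span (outer_square ` ?D)"
  obtain S where S: "S ` UNIV \<subseteq> ?V" "linear S" "\<And>v. v \<in> ?V \<Longrightarrow> S (T v) = v"
    using linear_exists_left_inverse_on[OF GL_tensorD(1)[OF T] subspace_tensor_space GL_tensorD(2)[OF T]]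
    by blast
  have TS: "T (S v) = v" if v: "v \<in> ?V" for v
  proof -
    obtain w where "w \<in> ?V" "v = T w"
      using v GL_tensorD(3)[OF T] by (metis imageE)
    then show ?thesis
      using S(3) by simp
  qed
  define T2 where "T2 M = matrix T ** M ** transpose (matrix T)" for M
  define S2 where "S2 M = matrix S ** M ** transpose (matrix S)" for M
  have "linear (\<lambda>M :: real ^ ('l \<Rightarrow> 'n) ^ ('l \<Rightarrow> 'n). A ** M)" "linear (\<lambda>M :: real ^ ('l \<Rightarrow> 'n) ^ ('l \<Rightarrow> 'n). M ** A)" for A :: "real ^ ('l \<Rightarrow> 'n) ^ ('l \<Rightarrow> 'n)"
    by (auto intro!: linearI simp: matrix_matrix_mult_def vec_eq_iff distrib_left distrib_right
        sum.distrib sum_distrib_left mult_ac)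
  then have lin: "linear (\<lambda>M. A ** M ** B)" for A B :: "real ^ ('l \<Rightarrow> 'n) ^ ('l \<Rightarrow> 'n)"
    using linear_compose[of "\<lambda>M. A ** M" "\<lambda>M. M ** B"] by (simp add: o_def)
  then have linT2: "linear T2" and linS2: "linear S2"
    unfolding T2_def S2_def by auto
  have T2: "T2 (outer_square z) = outer_square (T z)" for z
    using outer_square_matrix_mult[of "matrix T" z] GL_tensorD(1)[OF T] by (simp add: T2_def matrix_works)
  have S2: "S2 (outer_square z) = outer_square (S z)" for z
    using outer_square_matrix_mult[of "matrix S" z] S(2) by (simp add: S2_def matrix_works)
  have S2T2: "S2 (T2 M) = M" if M: "M \<in> W" for M
  proof -
    have "linear (S2 \<circ> T2)"
      using linT2 linS2 by (rule linear_compose)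
    moreover have "(S2 \<circ> T2) N = id N" if "N \<in> outer_square ` ?D" for N
      using that S(3) decomposables_subset[of K] by (auto simp: T2 S2)
    ultimately have "(S2 \<circ> T2) M = id M"
      using M unfolding W_def by (intro linear_eq_on[of "S2 \<circ> T2" id M]) (auto simp: linear_iff)
    then show ?thesis by simp
  qed
  have spanW: "span W = W"
    unfolding W_def by (rule span_span)
  have "T2 ` W \<subseteq> W"
  proof -
    have "T2 ` W = span (T2 ` outer_square ` ?D)"
      unfolding W_def by (rule linear_span_image[OF linT2, symmetric])
    also have "T2 ` outer_square ` ?D = outer_square ` T ` ?D"
      by (simp add: image_image T2)
    also have "span \<dots> \<subseteq> W"
      unfolding W_def using GL_tensorD(4)[OF T] by (intro span_mono image_mono)
    finally show ?thesis .
  qed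
  moreover have "dim (T2 ` W) = dim W"
    using S2T2 by (intro dim_image_eq linT2 inj_on_inverseI[of _ S2]) (simp only: spanW)
  ultimately have T2W: "T2 ` W = W"
    by (intro subspace_dim_equal linear_subspace_image linT2) (simp_all add: W_def)
  have "S v \<in> ?D" if v: "v \<in> ?D" for v
  proof -
    have vV: "v \<in> ?V"
      using v decomposables_subset by auto
    have "outer_square v \<in> W"
      using v by (auto simp: W_def intro: span_base)
    then obtain M where M: "M \<in> W" "outer_square v = T2 M"
      using T2W by (metis imageE)
    then have "outer_square (S v) \<in> W"
      using S2T2[OF M(1)] S2[of v] by simp
    moreover have "S v \<in> ?V"
      using S(1) by auto
    ultimately show ?thesis
      by (simp add: decomposable_iff_outer_square W_def)
  qed
  then have "S \<in> GL_tensor K"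
    by (intro GL_tensorI S(2) inj_on_inverseI[of _ T]) (auto simp: TS)
  then show ?thesis
    using that S(3) TS by blast
qed

lemma GL_tensor_scale:
  assumes T: "T \<in> GL_tensor K" and c: "c \<noteq> 0"
  shows "(\<lambda>z. c *\<^sub>R T z) \<in> GL_tensor K"
proof (rule GL_tensorI)
  show "linear (\<lambda>z. c *\<^sub>R T z)"
    using GL_tensorD(1)[OF T] by (simp add: linear_compose_scale_right)
  show "inj_on (\<lambda>z. c *\<^sub>R T z) (tensor_space K)"
    using GL_tensorD(2)[OF T] c by (auto simp: inj_on_def)
  show "(\<lambda>z. c *\<^sub>R T z) ` decomposables K \<subseteq> decomposables K"
    using GL_tensorD(4)[OF T] by (auto intro: decomposables_scale)
qed

lemma GL_tensor_id: "(\<lambda>z. z) \<in> GL_tensor K"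
  by (intro GL_tensorI) (auto simp: linear_iff)

lemma GL_tensor_compose:
  assumes T: "T \<in> GL_tensor K" and S: "S \<in> GL_tensor K"
  shows "(\<lambda>z. S (T z)) \<in> GL_tensor K"
proof (rule GL_tensorI)
  show "linear (\<lambda>z. S (T z))"
    using linear_compose[OF GL_tensorD(1)[OF T] GL_tensorD(1)[OF S]] by (simp add: o_def)
  show "inj_on (\<lambda>z. S (T z)) (tensor_space K)"
    using GL_tensorD(2,3)[OF T] GL_tensorD(2)[OF S] comp_inj_on[of T "tensor_space K" S]
    by (simp add: o_def)
  show "(\<lambda>z. S (T z)) ` decomposables K \<subseteq> decomposables K"
    using GL_tensorD(4)[OF T] GL_tensorD(4)[OF S] by auto
qed

section \<open>The tensorial Banach-Mazur distance on bodies\<close>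

lemma tensorial_body_body: "P \<in> tensorial_bodies K \<Longrightarrow> sym_convex_body (tensor_space K) P"
  by (simp add: tensorial_bodies_def)

lemma tensor_BM_dist_le:
  assumes "1 \<le> r" "T \<in> GL_tensor K" "Q \<subseteq> T ` P" "T ` P \<subseteq> (*\<^sub>R) r ` Q"
  shows "tensor_BM_dist K P Q \<le> r"
  unfolding tensor_BM_dist_def using assms by (intro cInf_lower bdd_belowI[of _ 1]) auto

text \<open>It suffices to take \<open>T\<close> a multiple of the identity. With \<open>r\<close>, \<open>R\<close> and \<open>r'\<close>, \<open>R'\<close> the radii of
  inner and outer balls of \<open>P\<close> and \<open>Q\<close>, the multiple \<open>R' / r\<close> makes \<open>P\<close> large enough.\<close>

lemma tensor_BM_dist_nonempty:
  assumes P: "sym_convex_body (tensor_space K) P" and Q: "sym_convex_body (tensor_space K) Q"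
  shows "\<exists>r\<ge>1. \<exists>T\<in>GL_tensor K. Q \<subseteq> T ` P \<and> T ` P \<subseteq> (*\<^sub>R) r ` Q"
proof -
  note V = subspace_tensor_space[of K]
  obtain r R where r: "0 < r" "0 < R" "cball 0 r \<inter> tensor_space K \<subseteq> P" "P \<subseteq> cball 0 R"
    using sym_convex_body_bounds[OF V P] .
  obtain r' R' where r': "0 < r'" "0 < R'" "cball 0 r' \<inter> tensor_space K \<subseteq> Q" "Q \<subseteq> cball 0 R'"
    using sym_convex_body_bounds[OF V Q] .
  define c where "c = R' / r"
  define q where "q = max 1 (c * R / r')"
  have c: "0 < c" and q: "1 \<le> q" "c * R \<le> q * r'"
    using r r' by (auto simp: c_def q_def max_def field_simps)
  have "Q \<subseteq> (*\<^sub>R) c ` P"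
  proof
    fix z assume z: "z \<in> Q"
    then have "norm (inverse c *\<^sub>R z) \<le> inverse c * R'"
      using r' c by (auto intro!: mult_left_mono)
    then have "inverse c *\<^sub>R z \<in> cball 0 r \<inter> tensor_space K"
      using r r' z sym_convex_bodyD(1)[OF Q] V by (auto simp: c_def intro!: subspace_mul)
    then show "z \<in> (*\<^sub>R) c ` P"
      using r(3) c by (auto simp: mem_scaleR_image_iff)
  qed
  moreover have "(*\<^sub>R) c ` P \<subseteq> (*\<^sub>R) q ` Q"
  proof
    fix z assume z: "z \<in> (*\<^sub>R) c ` P"
    then obtain p where p: "p \<in> P" "z = c *\<^sub>R p" by auto
    have "norm z \<le> c * R"
      using p r c by auto
    then have "norm (inverse q *\<^sub>R z) \<le> r'"
      using q by (simp add: field_simps)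
    moreover have "inverse q *\<^sub>R z \<in> tensor_space K"
      using p sym_convex_bodyD(1)[OF P] V by (auto intro!: subspace_mul)
    ultimately have "inverse q *\<^sub>R z \<in> Q"
      using r'(3) by auto
    then show "z \<in> (*\<^sub>R) q ` Q"
      using q by (simp add: mem_scaleR_image_iff)
  qed
  ultimately show ?thesis
    using q c GL_tensor_scale[OF GL_tensor_id, of c K] by (intro exI[of _ q] bexI[of _ "(*\<^sub>R) c"]) auto
qed

lemma tensor_BM_dist_ge_1:
  assumes P: "P \<in> tensorial_bodies K" and Q: "Q \<in> tensorial_bodies K"
  shows "1 \<le> tensor_BM_dist K P Q"
  unfolding tensor_BM_dist_def
  using tensor_BM_dist_nonempty[OF P[THEN tensorial_body_body] Q[THEN tensorial_body_body]]
  by (intro cInf_greatest) auto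

lemma tensor_BM_dist_approx:
  assumes P: "P \<in> tensorial_bodies K" and Q: "Q \<in> tensorial_bodies K" and r: "tensor_BM_dist K P Q < r"
  obtains q T where "1 \<le> q" "q < r" "T \<in> GL_tensor K" "Q \<subseteq> T ` P" "T ` P \<subseteq> (*\<^sub>R) q ` Q"
proof -
  have "{r. 1 \<le> r \<and> (\<exists>T\<in>GL_tensor K. Q \<subseteq> T ` P \<and> T ` P \<subseteq> (*\<^sub>R) r ` Q)} \<noteq> {}"
    using tensor_BM_dist_nonempty[OF P[THEN tensorial_body_body] Q[THEN tensorial_body_body]] by auto
  from cInf_lessD[OF this r[unfolded tensor_BM_dist_def]] show ?thesis
    using that by auto
qed

lemma tensor_BM_dist_refl:
  assumes P: "P \<in> tensorial_bodies K"
  shows "tensor_BM_dist K P P = 1"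
proof (rule antisym)
  show "tensor_BM_dist K P P \<le> 1"
    by (rule tensor_BM_dist_le[OF _ GL_tensor_id]) auto
qed (rule tensor_BM_dist_ge_1[OF P P])

text \<open>If \<open>Q \<subseteq> T P \<subseteq> q Q\<close>, then \<open>q T\<^sup>-\<^sup>1\<close> maps \<open>Q\<close> between \<open>P\<close> and \<open>q P\<close>.\<close>

lemma tensor_BM_dist_sym_le:
  assumes P: "P \<in> tensorial_bodies K" and Q: "Q \<in> tensorial_bodies K"
  shows "tensor_BM_dist K Q P \<le> tensor_BM_dist K P Q"
proof (rule field_le_epsilon)
  fix e :: real assume "0 < e"
  then obtain q T where q: "1 \<le> q" "q < tensor_BM_dist K P Q + e" and T: "T \<in> GL_tensor K"
    and sub: "Q \<subseteq> T ` P" "T ` P \<subseteq> (*\<^sub>R) q ` Q"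
    using tensor_BM_dist_approx[OF P Q, of "tensor_BM_dist K P Q + e"] by auto
  obtain S where S: "S \<in> GL_tensor K" "\<And>z. z \<in> tensor_space K \<Longrightarrow> S (T z) = z"
    using GL_tensor_inverse[OF T] by metis
  have ST: "S (T z) = z" if "z \<in> P" for z
    using that S(2) sym_convex_bodyD(1)[OF P[THEN tensorial_body_body]] by auto
  have scale: "S (c *\<^sub>R z) = c *\<^sub>R S z" for c z
    using GL_tensorD(1)[OF S(1)] by (rule linear_scale)
  have "tensor_BM_dist K Q P \<le> q"
  proof (rule tensor_BM_dist_le[OF q(1) GL_tensor_scale[OF S(1)]])
    show "q \<noteq> 0" using q by auto
    show "P \<subseteq> (\<lambda>z. q *\<^sub>R S z) ` Q"
    proof
      fix z assume z: "z \<in> P"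
      then obtain w where w: "w \<in> Q" "T z = q *\<^sub>R w"
        using sub(2) by blast
      then have "z = q *\<^sub>R S w"
        using ST[OF z] scale by metis
      then show "z \<in> (\<lambda>z. q *\<^sub>R S z) ` Q"
        using w by auto
    qed
    show "(\<lambda>z. q *\<^sub>R S z) ` Q \<subseteq> (*\<^sub>R) q ` P"
    proof
      fix z assume "z \<in> (\<lambda>z. q *\<^sub>R S z) ` Q"
      then obtain w where w: "w \<in> Q" "z = q *\<^sub>R S w" by auto
      then obtain p where "p \<in> P" "w = T p"
        using sub(1) by auto
      then show "z \<in> (*\<^sub>R) q ` P"
        using w ST by auto
    qed
  qed
  then show "tensor_BM_dist K Q P \<le> tensor_BM_dist K P Q + e"
    using q by simp
qed

lemma tensor_BM_dist_sym:
  assumes "P \<in> tensorial_bodies K" "Q \<in> tensorial_bodies K"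
  shows "tensor_BM_dist K Q P = tensor_BM_dist K P Q"
  using tensor_BM_dist_sym_le assms by (metis antisym)

lemma tensor_BM_dist_triangle:
  assumes P: "P \<in> tensorial_bodies K" and Q: "Q \<in> tensorial_bodies K" and R: "R \<in> tensorial_bodies K"
  shows "tensor_BM_dist K P R \<le> tensor_BM_dist K P Q * tensor_BM_dist K Q R"
proof -
  let ?d = "tensor_BM_dist K"
  have *: "?d P R \<le> a * b" if ab: "?d P Q < a" "?d Q R < b" for a b
  proof -
    obtain p T where p: "1 \<le> p" "p < a" and T: "T \<in> GL_tensor K" "Q \<subseteq> T ` P" "T ` P \<subseteq> (*\<^sub>R) p ` Q"
      using tensor_BM_dist_approx[OF P Q ab(1)] .
    obtain q S where q: "1 \<le> q" "q < b" and S: "S \<in> GL_tensor K" "R \<subseteq> S ` Q" "S ` Q \<subseteq> (*\<^sub>R) q ` R"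
      using tensor_BM_dist_approx[OF Q R ab(2)] .
    have "?d P R \<le> p * q"
    proof (rule tensor_BM_dist_le[OF _ GL_tensor_compose[OF T(1) S(1)]])
      show "1 \<le> p * q"
        using mult_mono[of 1 p 1 q] p q by simp
      show "R \<subseteq> (\<lambda>z. S (T z)) ` P"
        using S(2) T(2) by blast
      show "(\<lambda>z. S (T z)) ` P \<subseteq> (*\<^sub>R) (p * q) ` R"
      proof
        fix z assume "z \<in> (\<lambda>z. S (T z)) ` P"
        then obtain w where w: "w \<in> P" "z = S (T w)" by auto
        then obtain v where v: "v \<in> Q" "T w = p *\<^sub>R v"
          using T(3) by blast
        then obtain u where "u \<in> R" "S v = q *\<^sub>R u"
          using S(3) by blast
        then have "z = (p * q) *\<^sub>R u"
          using w v linear_scale[OF GL_tensorD(1)[OF S(1)]] by simp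
        then show "z \<in> (*\<^sub>R) (p * q) ` R"
          using \<open>u \<in> R\<close> by blast
      qed
    qed
    also have "p * q \<le> a * b"
      using p q by (intro mult_mono) auto
    finally show ?thesis .
  qed
  have "((\<lambda>e. (?d P Q + e) * (?d Q R + e)) \<longlongrightarrow> (?d P Q + 0) * (?d Q R + 0)) (at_right 0)"
    by (intro tendsto_intros)
  moreover have "\<forall>\<^sub>F e in at_right 0. ?d P R \<le> (?d P Q + e) * (?d Q R + e)"
    by (rule eventually_mono[OF eventually_at_right_less]) (auto intro: *)
  ultimately show ?thesis
    by (intro tendsto_lowerbound[of "\<lambda>e. (?d P Q + e) * (?d Q R + e)"]) auto
qed

section \<open>Normal position of a tensorial body\<close>

lemma inner_axis_left: "axis k 1 \<bullet> (x :: real ^ 'n::finite) = x $ k"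
  by (simp add: inner_commute[of "axis k 1"] inner_axis)

lemma axis_mem_coord_space: "k \<in> A \<Longrightarrow> axis k 1 \<in> coord_space A"
  by (auto simp: coord_space_def axis_def)

text \<open>An injective map of a finite-dimensional space into itself is onto.\<close>

lemma left_inverse_preserves_coord_space:
  fixes A :: "real ^ 'n::finite ^ 'n"
  assumes inv: "B ** A = mat 1" and A: "\<And>x. x \<in> coord_space J \<Longrightarrow> A *v x \<in> coord_space J"
    and y: "y \<in> coord_space J"
  shows "B *v y \<in> coord_space J"
proof -
  have BA: "B *v (A *v x) = x" for x
    by (simp add: matrix_vector_mul_assoc inv)
  have "(*v) A ` coord_space J = coord_space J"
  proof (intro subspace_dim_equal linear_subspace_image subspace_coord_space matrix_vector_mul_linear)
    have "dim ((*v) A ` coord_space J) = dim (coord_space J)"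
      by (intro dim_image_eq matrix_vector_mul_linear inj_on_inverseI[of _ "(*v) B"]) (rule BA)
    then show "dim (coord_space J) \<le> dim ((*v) A ` coord_space J)" by simp
  qed (use A in auto)
  then obtain x where "x \<in> coord_space J" "y = A *v x"
    using y by auto
  then show ?thesis
    using BA by simp
qed

text \<open>Auerbach's lemma. Among the matrices whose columns indexed by \<open>J\<close> lie in \<open>Q\<close> and whose other columns
  are standard basis vectors, take one with maximal absolute determinant. By Cramer's rule,
  replacing column \<open>k\<close> by \<open>A *v x\<close> multiplies the determinant by \<open>x $ k\<close>, so maximality forces
  \<open>\<bar>x $ k\<bar> \<le> 1\<close> when \<open>A *v x \<in> Q\<close>.\<close>

lemma auerbach_matrix:
  fixes J :: "'n::finite set"
  assumes Q: "sym_convex_body (coord_space J) Q"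
  obtains A :: "real ^ 'n ^ 'n" where "det A \<noteq> 0"
    "\<And>k. k \<in> J \<Longrightarrow> column k A \<in> Q" "\<And>k. k \<notin> J \<Longrightarrow> column k A = axis k 1"
    "\<And>x k. k \<in> J \<Longrightarrow> A *v x \<in> Q \<Longrightarrow> \<bar>x $ k\<bar> \<le> 1"
proof -
  \<comment> \<open>Compactness and the maximisation are for the transposed matrices, whose rows are components.\<close>
  define C where "C k = (if k \<in> J then Q else {axis k 1})" for k :: 'n
  define M :: "(real ^ 'n ^ 'n) set" where "M = {B. \<forall>k. B $ k \<in> C k}"
  have C: "compact (C k)" for k
    using sym_convex_bodyD(2)[OF Q] by (simp add: C_def)
  have "closed M"
    unfolding M_def by (intro closed_vector_box allI compact_imp_closed C)
  moreover have "bounded M"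
  proof -
    obtain c where c: "\<And>k x. x \<in> C k \<Longrightarrow> norm x \<le> c k"
      using C[THEN compact_imp_bounded] unfolding bounded_iff by metis
    have "norm B \<le> (\<Sum>k\<in>UNIV. c k)" if "B \<in> M" for B
    proof -
      have "norm B \<le> (\<Sum>k\<in>UNIV. norm (B $ k))"
        by (simp add: norm_vec_def L2_set_le_sum)
      also have "\<dots> \<le> (\<Sum>k\<in>UNIV. c k)"
        using that by (intro sum_mono c) (auto simp: M_def)
      finally show ?thesis .
    qed
    then show ?thesis
      by (auto simp: bounded_iff)
  qed
  ultimately have "compact M"
    by (simp add: compact_eq_bounded_closed)
  obtain r where r: "0 < r" "cball 0 r \<inter> coord_space J \<subseteq> Q"
    using sym_convex_body_ball[OF subspace_coord_space Q] .
  \<comment> \<open>A competitor with nonzero determinant.\<close>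
  define D :: "real ^ 'n ^ 'n" where "D = (\<chi> k. (if k \<in> J then r else 1) *\<^sub>R axis k 1)"
  have D: "D \<in> M"
  proof -
    have "r *\<^sub>R axis k 1 \<in> Q" if "k \<in> J" for k
      using r(1) that by (intro subsetD[OF r(2)])
        (auto intro: subspace_mul subspace_coord_space axis_mem_coord_space)
    then show ?thesis
      by (auto simp: M_def C_def D_def)
  qed
  have "det D = (\<Prod>k\<in>UNIV. D $ k $ k)"
    by (intro det_diagonal) (auto simp: D_def axis_def)
  then have "det D \<noteq> 0"
    using r(1) by (auto simp: D_def axis_def)
  have "continuous_on M (\<lambda>B. \<bar>det B\<bar>)"
    unfolding det_def by (intro continuous_intros)
  then obtain B where B: "B \<in> M" and max: "\<And>B'. B' \<in> M \<Longrightarrow> \<bar>det B'\<bar> \<le> \<bar>det B\<bar>"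
    using continuous_attains_sup[OF \<open>compact M\<close>] D by (metis empty_iff)
  have "det B \<noteq> 0"
    using max[OF D] \<open>det D \<noteq> 0\<close> by auto
  define A where "A = transpose B"
  have col: "column k A = B $ k" for k
    by (simp add: A_def column_def transpose_def vec_eq_iff)
  show ?thesis
  proof
    show "det A \<noteq> 0"
      using \<open>det B \<noteq> 0\<close> by (simp add: A_def)
    show "column k A \<in> Q" if "k \<in> J" for k
      using B that unfolding M_def C_def col by (metis (mono_tags, lifting) mem_Collect_eq)
    show "column k A = axis k 1" if "k \<notin> J" for k
      using B that unfolding M_def C_def col by (auto dest: spec[of _ k])
    show "\<bar>x $ k\<bar> \<le> 1" if k: "k \<in> J" and x: "A *v x \<in> Q" for x k
    proof -
      define B' :: "real ^ 'n ^ 'n" where "B' = (\<chi> j. if j = k then A *v x else B $ j)"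
      have "B' \<in> M"
        using B x k by (simp add: M_def B'_def) (simp add: C_def)
      have "B' = transpose (\<chi> i j. if j = k then (A *v x) $ i else A $ i $ j)"
        by (simp add: B'_def A_def transpose_def vec_eq_iff)
      then have "det B' = x $ k * det A"
        by (simp only: cramer_lemma det_transpose)
      then have "\<bar>x $ k\<bar> * \<bar>det B\<bar> \<le> 1 * \<bar>det B\<bar>"
        using max[OF \<open>B' \<in> M\<close>] by (simp add: A_def abs_mult)
      then show ?thesis
        using \<open>det B \<noteq> 0\<close> by (simp only: mult_le_cancel_right)
    qed
  qed
qed

text \<open>The tensor product of the linear maps given by the matrices \<open>A i\<close>.\<close>

definition tensor_map :: "('l::finite \<Rightarrow> real ^ 'n::finite ^ 'n) \<Rightarrow> real ^ ('l \<Rightarrow> 'n) \<Rightarrow> real ^ ('l \<Rightarrow> 'n)" where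
  "tensor_map A z = (\<chi> s t. \<Prod>i\<in>UNIV. A i $ s i $ t i) *v z"

lemma linear_tensor_map: "linear (tensor_map A)"
  unfolding tensor_map_def by (rule matrix_vector_mul_linear)

lemma tensor_map_elem_tensor: "tensor_map A (elem_tensor x) = elem_tensor (\<lambda>i. A i *v x i)"
proof -
  have "(\<Prod>i\<in>UNIV. \<Sum>k\<in>UNIV. A i $ s i $ k * x i $ k) =
      (\<Sum>t\<in>PiE UNIV (\<lambda>_. UNIV). \<Prod>i\<in>UNIV. A i $ s i $ t i * x i $ t i)" for s
    by (rule prod_sum_PiE) auto
  then show ?thesis
    by (simp add: tensor_map_def elem_tensor_def matrix_vector_mult_def vec_eq_iff prod.distrib)
qed

lemma tensor_map_inner_elem_tensor:
  "tensor_map A z \<bullet> elem_tensor y = z \<bullet> elem_tensor (\<lambda>i. transpose (A i) *v y i)"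
proof -
  have "(\<chi> s t. \<Prod>i\<in>UNIV. transpose (A i) $ s i $ t i) = transpose (\<chi> s t. \<Prod>i\<in>UNIV. A i $ s i $ t i)"
    by (simp add: transpose_def)
  then have "z \<bullet> tensor_map (\<lambda>i. transpose (A i)) (elem_tensor y) = tensor_map A z \<bullet> elem_tensor y"
    unfolding tensor_map_def by (simp add: dot_lmul_matrix vector_transpose_matrix flip: vector_transpose_matrix)
  then show ?thesis
    by (simp add: tensor_map_elem_tensor)
qed

text \<open>The tensor product of left inverses is a left inverse, because linear maps that agree on
  decomposables agree on the tensor space.\<close>

lemma tensor_map_GL:
  fixes K :: "'l::finite \<Rightarrow> 'n::finite set"
  assumes A: "\<And>i x. x \<in> coord_space (K i) \<Longrightarrow> A i *v x \<in> coord_space (K i)" and inv: "\<And>i. B i ** A i = mat 1"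
  shows "tensor_map A \<in> GL_tensor K"
proof (rule GL_tensorI[OF linear_tensor_map])
  have "tensor_map B (tensor_map A z) = z" if z: "z \<in> tensor_space K" for z
  proof -
    have "linear (tensor_map B \<circ> tensor_map A)"
      by (intro linear_compose linear_tensor_map)
    moreover have "(tensor_map B \<circ> tensor_map A) w = id w" if "w \<in> decomposables K" for w
      using that by (auto simp: decomposables_def tensor_map_elem_tensor matrix_vector_mul_assoc inv)
    ultimately have "(tensor_map B \<circ> tensor_map A) z = id z"
      using z by (intro linear_eq_on[of "tensor_map B \<circ> tensor_map A" id z "decomposables K"])
        (auto simp: linear_iff span_decomposables)
    then show ?thesis by simp
  qed
  then show "inj_on (tensor_map A) (tensor_space K)"
    by (rule inj_on_inverseI)
  show "tensor_map A ` decomposables K \<subseteq> decomposables K"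
    using A by (force simp: decomposables_def tensor_map_elem_tensor)
qed

text \<open>A vector \<open>x\<close> is the average of the \<open>CARD('k)\<close> vectors \<open>(CARD('k) * x $ k) *\<^sub>R axis k 1\<close>.\<close>

lemma cross_polytope_ball:
  fixes Q :: "(real ^ 'k::finite) set"
  assumes "convex Q" "\<And>x. x \<in> Q \<Longrightarrow> - x \<in> Q" and ax: "\<And>k. k \<in> A \<Longrightarrow> axis k 1 \<in> Q" and "A \<noteq> {}"
  shows "cball 0 (1 / CARD('k)) \<inter> coord_space A \<subseteq> Q"
proof
  fix x :: "real ^ 'k" assume x: "x \<in> cball 0 (1 / CARD('k)) \<inter> coord_space A"
  obtain a where "a \<in> A" using \<open>A \<noteq> {}\<close> by auto
  have "(1/2) *\<^sub>R axis a 1 + (1/2) *\<^sub>R (- axis a 1) \<in> Q"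
    using assms(2)[OF ax] ax \<open>a \<in> A\<close> by (intro convexD[OF assms(1)]) auto
  then have zero: "0 \<in> Q" by simp
  have scaled: "t *\<^sub>R axis k 1 \<in> Q" if "k \<in> A" "\<bar>t\<bar> \<le> 1" for k t
  proof -
    have "\<bar>t\<bar> *\<^sub>R (sgn t *\<^sub>R axis k 1) + (1 - \<bar>t\<bar>) *\<^sub>R 0 \<in> Q"
      using that zero ax assms(2)[OF ax] by (intro convexD[OF assms(1)]) (auto simp: sgn_if)
    then show ?thesis
      by (simp add: abs_mult_sgn)
  qed
  have "\<bar>CARD('k) * x $ k\<bar> \<le> 1" for k
  proof -
    have "CARD('k) * \<bar>x $ k\<bar> \<le> CARD('k) * norm x"
      by (intro mult_left_mono component_le_norm_cart) simp
    also have "\<dots> \<le> 1"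
      using x by (simp add: field_simps)
    finally show ?thesis
      by (simp add: abs_mult)
  qed
  then have "(CARD('k) * x $ k) *\<^sub>R axis k 1 \<in> Q" for k
    using x scaled zero by (cases "k \<in> A") (auto simp: coord_space_def)
  then have "(\<Sum>k\<in>UNIV. (1 / CARD('k)) *\<^sub>R ((CARD('k) * x $ k) *\<^sub>R axis k 1)) \<in> Q"
    by (intro convex_sum[OF _ assms(1)]) auto
  also have "(\<Sum>k\<in>UNIV. (1 / CARD('k)) *\<^sub>R ((CARD('k) * x $ k) *\<^sub>R axis k 1)) = x"
    using basis_expansion[of x] by (simp add: scalar_mult_eq_scaleR)
  finally show "x \<in> Q" .
qed

lemma norm_le_card:
  fixes x :: "real ^ 'k::finite"
  assumes "x \<in> coord_space A" "\<And>k. k \<in> A \<Longrightarrow> \<bar>x $ k\<bar> \<le> 1"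
  shows "norm x \<le> CARD('k)"
proof -
  have "\<bar>x $ k\<bar> \<le> 1" for k
    using assms by (cases "k \<in> A") (auto simp: coord_space_def)
  then have "(\<Sum>k\<in>UNIV. \<bar>x $ k\<bar>) \<le> (\<Sum>k\<in>(UNIV::'k set). 1)"
    by (intro sum_mono) auto
  then show ?thesis
    using norm_le_l1_cart[of x] by simp
qed

lemma proj_tensor_subset_iff:
  assumes "convex P"
  shows "proj_tensor Q \<subseteq> P \<longleftrightarrow> (\<forall>x. (\<forall>i. x i \<in> Q i) \<longrightarrow> elem_tensor x \<in> P)"
  unfolding proj_tensor_def subset_hull[of convex, OF assms] by auto

lemma mem_inj_tensor_iff:
  "z \<in> inj_tensor K Q \<longleftrightarrow> z \<in> tensor_space K \<and>
     (\<forall>y. (\<forall>i. y i \<in> polar (coord_space (K i)) (Q i)) \<longrightarrow> \<bar>z \<bullet> elem_tensor y\<bar> \<le> 1)"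
proof -
  have "convex {w. z \<bullet> w \<le> 1}" "convex {w. z \<bullet> w \<ge> -1}"
    by (rule convex_halfspace_le convex_halfspace_ge)+
  then have "convex ({w. z \<bullet> w \<le> 1} \<inter> {w. z \<bullet> w \<ge> -1})"
    by (rule convex_Int)
  also have "{w. z \<bullet> w \<le> 1} \<inter> {w. z \<bullet> w \<ge> -1} = {w. \<bar>w \<bullet> z\<bar> \<le> 1}"
    by (auto simp: inner_commute)
  finally show ?thesis
    using proj_tensor_subset_iff[of "{w. \<bar>w \<bullet> z\<bar> \<le> 1}"]
    by (auto simp: inj_tensor_def polar_def subset_eq inner_commute)
qed

definition tensorial_pair ::
  "('l::finite \<Rightarrow> 'n::finite set) \<Rightarrow> (real ^ ('l \<Rightarrow> 'n)) set \<Rightarrow> ('l \<Rightarrow> (real ^ 'n) set) \<Rightarrow> bool" where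
  "tensorial_pair K P Q \<longleftrightarrow> sym_convex_body (tensor_space K) P \<and>
     (\<forall>i. sym_convex_body (coord_space (K i)) (Q i)) \<and> proj_tensor Q \<subseteq> P \<and> P \<subseteq> inj_tensor K Q"

lemma tensorial_bodies_iff: "P \<in> tensorial_bodies K \<longleftrightarrow> (\<exists>Q. tensorial_pair K P Q)"
  by (auto simp: tensorial_bodies_def tensorial_pair_def)

text \<open>For symmetric convex \<open>Q i\<close> in \<open>coord_space (K i)\<close>: each \<open>Q i\<close> lies between the standard
  cross-polytope and the cube.\<close>

definition normalised :: "('l \<Rightarrow> 'n::finite set) \<Rightarrow> ('l \<Rightarrow> (real ^ 'n) set) \<Rightarrow> bool" where
  "normalised K Q \<longleftrightarrow> (\<forall>i. \<forall>k\<in>K i. axis k 1 \<in> Q i) \<and> (\<forall>i. \<forall>x\<in>Q i. \<forall>k\<in>K i. \<bar>x $ k\<bar> \<le> (1::real))"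

text \<open>The basis tensors are the elementary tensors of basis vectors. Those vectors lie in the factors,
  which puts the basis tensors into the projective product, and in the polars of the factors, which
  bounds the coordinates of the elements of the injective product.\<close>

lemma normalised_elem_tensor:
  fixes K :: "'l::finite \<Rightarrow> 'n::finite set"
  assumes P: "convex P" "proj_tensor Q \<subseteq> P" "P \<subseteq> inj_tensor K Q" and Q: "normalised K Q" and s: "s \<in> Pi UNIV K"
  shows "axis s 1 \<in> P" "z \<in> P \<Longrightarrow> \<bar>z $ s\<bar> \<le> 1"
proof -
  have axis: "axis s 1 = (elem_tensor (\<lambda>i. axis (s i) 1) :: real ^ ('l \<Rightarrow> 'n))"
    by (auto simp: elem_tensor_def axis_def vec_eq_iff fun_eq_iff prod_zero_iff)
  show "axis s 1 \<in> P"
    unfolding axis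
  proof (rule P(2)[unfolded proj_tensor_subset_iff[OF P(1)], rule_format])
    show "axis (s i) 1 \<in> Q i" for i
      using Q s by (auto simp: normalised_def)
  qed
  assume "z \<in> P"
  moreover have "axis (s i) 1 \<in> polar (coord_space (K i)) (Q i)" for i
  proof -
    have "s i \<in> K i"
      using s by auto
    then show ?thesis
      using Q by (auto simp: polar_def normalised_def inner_axis intro: axis_mem_coord_space)
  qed
  ultimately have "\<bar>z \<bullet> axis s 1\<bar> \<le> 1"
    unfolding axis using P(3) by (auto simp: mem_inj_tensor_iff)
  then show "\<bar>z $ s\<bar> \<le> 1"
    by (simp add: inner_axis)
qed

lemma normalised_bounds:
  fixes K :: "'l::finite \<Rightarrow> 'n::finite set"
  assumes K: "\<And>i. K i \<noteq> {}" and PQ: "tensorial_pair K P Q" "normalised K Q"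
  shows "cball 0 (1 / CARD('n)) \<inter> coord_space (K i) \<subseteq> Q i" "Q i \<subseteq> cball 0 CARD('n)"
    "cball 0 (1 / CARD('l \<Rightarrow> 'n)) \<inter> tensor_space K \<subseteq> P" "P \<subseteq> cball 0 CARD('l \<Rightarrow> 'n)"
proof -
  have Q: "\<And>i. sym_convex_body (coord_space (K i)) (Q i)"
    and P: "sym_convex_body (tensor_space K) P"
    and sub: "proj_tensor Q \<subseteq> P" "P \<subseteq> inj_tensor K Q"
    using PQ by (auto simp: tensorial_pair_def)
  note [simp] = sym_convex_bodyD(4)[OF Q] sym_convex_bodyD(5)[OF Q] sym_convex_bodyD(4)[OF P] sym_convex_bodyD(5)[OF P]
  show "cball 0 (1 / CARD('n)) \<inter> coord_space (K i) \<subseteq> Q i"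
    using PQ(2) K by (intro cross_polytope_ball) (auto simp: normalised_def)
  show "Q i \<subseteq> cball 0 CARD('n)"
    using PQ(2) sym_convex_bodyD(1)[OF Q[of i]] by (auto simp: normalised_def intro!: norm_le_card)
  note norm = normalised_elem_tensor[OF sym_convex_bodyD(4)[OF P] sub PQ(2)]
  show "cball 0 (1 / CARD('l \<Rightarrow> 'n)) \<inter> tensor_space K \<subseteq> P"
    unfolding tensor_space_def using K by (intro cross_polytope_ball norm) (auto simp: Pi_eq_empty)
  show "P \<subseteq> cball 0 CARD('l \<Rightarrow> 'n)"
    using norm(2) sym_convex_bodyD(1)[OF P] by (auto simp: tensor_space_def intro!: norm_le_card)
qed

lemma linear_image_sym:
  assumes "linear T" "\<And>x. x \<in> Q \<Longrightarrow> - x \<in> Q" "y \<in> T ` Q"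
  shows "- y \<in> T ` Q"
  using assms by (metis (no_types, lifting) image_iff linear_neg)

text \<open>The matrices \<open>A i\<close> with Auerbach columns map basis vectors into \<open>Q i\<close>, so their inverses \<open>B i\<close>
  bring \<open>Q i\<close> into normalised position. The tensor product of the \<open>B i\<close> carries the projective
  product along; for the injective product one passes to the transposes, which map the polar of
  \<open>B i ` Q i\<close> into that of \<open>Q i\<close>.\<close>

theorem normalisation:
  fixes K :: "'l::finite \<Rightarrow> 'n::finite set"
  assumes K: "\<And>i. K i \<noteq> {}" and P: "P \<in> tensorial_bodies K"
  obtains T Q' where "T \<in> GL_tensor K" "tensorial_pair K (T ` P) Q'" "normalised K Q'"
proof -
  obtain Q where Pb: "sym_convex_body (tensor_space K) P" and Q: "\<And>i. sym_convex_body (coord_space (K i)) (Q i)"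
    and sub: "proj_tensor Q \<subseteq> P" "P \<subseteq> inj_tensor K Q"
    using P by (auto simp: tensorial_bodies_def)
  have "\<exists>A :: real ^ 'n ^ 'n. det A \<noteq> 0 \<and> (\<forall>k\<in>K i. column k A \<in> Q i) \<and> (\<forall>k. k \<notin> K i \<longrightarrow> column k A = axis k 1) \<and>
      (\<forall>x k. k \<in> K i \<longrightarrow> A *v x \<in> Q i \<longrightarrow> \<bar>x $ k\<bar> \<le> 1)" for i
    using auerbach_matrix[OF Q[of i]] by metis
  then obtain A :: "'l \<Rightarrow> real ^ 'n ^ 'n" where A: "\<And>i. det (A i) \<noteq> 0" "\<And>i k. k \<in> K i \<Longrightarrow> column k (A i) \<in> Q i"
    "\<And>i k. k \<notin> K i \<Longrightarrow> column k (A i) = axis k 1" "\<And>i x k. k \<in> K i \<Longrightarrow> A i *v x \<in> Q i \<Longrightarrow> \<bar>x $ k\<bar> \<le> 1"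
    by metis
  have "\<exists>B. A i ** B = mat 1 \<and> B ** A i = mat 1" for i
    using A(1)[of i] by (simp add: invertible_def flip: invertible_det_nz)
  then obtain B where AB: "\<And>i. A i ** B i = mat 1" "\<And>i. B i ** A i = mat 1"
    by metis
  have col: "k \<in> K i \<Longrightarrow> column k (A i) \<in> coord_space (K i)" for i k
    using A(2) sym_convex_bodyD(1)[OF Q] by blast
  have A_mem: "A i *v x \<in> coord_space (K i)" if "x \<in> coord_space (K i)" for i x
  proof -
    have "x $ k *s column k (A i) \<in> coord_space (K i)" for k
      using that col[of k i] subspace_mul[OF subspace_coord_space col]
      by (cases "k \<in> K i") (auto simp: coord_space_def scalar_mult_eq_scaleR)
    then show ?thesis
      unfolding matrix_mult_sum by (intro subspace_sum subspace_coord_space)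
  qed
  \<comment> \<open>The transpose preserves the coordinate space because \<open>A i\<close> fixes the basis vectors outside \<open>K i\<close>;
    this makes \<open>transpose (B i)\<close> map polars, which are subsets of that space, to polars.\<close>
  have AT_mem: "transpose (A i) *v x \<in> coord_space (K i)" if "x \<in> coord_space (K i)" for i x
  proof -
    have "(transpose (A i) *v x) $ k = column k (A i) \<bullet> x" for k
      by (simp add: matrix_vector_mult_def transpose_def column_def inner_vec_def)
    then show ?thesis
      using A(3) that by (simp add: coord_space_def inner_axis_left)
  qed
  have B_mem: "B i *v x \<in> coord_space (K i)" if "x \<in> coord_space (K i)" for i x
    using left_inverse_preserves_coord_space[OF AB(2) A_mem that] .
  have BT: "transpose (B i) ** transpose (A i) = mat 1" for i
    using AB(1)[of i] by (metis matrix_transpose_mul transpose_mat)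
  have BT_mem: "transpose (B i) *v x \<in> coord_space (K i)" if "x \<in> coord_space (K i)" for i x
    using left_inverse_preserves_coord_space[OF BT AT_mem that] .
  define T where "T = tensor_map B"
  define Q' where "Q' i = (*v) (B i) ` Q i" for i
  have T: "T \<in> GL_tensor K"
    unfolding T_def using tensor_map_GL[OF B_mem AB(1)] .
  have ABx: "A i *v (B i *v x) = x" for i x
    by (simp add: matrix_vector_mul_assoc AB)
  have BAx: "B i *v (A i *v x) = x" for i x
    by (simp add: matrix_vector_mul_assoc AB)
  have norm: "normalised K Q'"
    unfolding normalised_def
  proof (intro conjI allI ballI)
    show "axis k 1 \<in> Q' i" if "k \<in> K i" for i k
    proof -
      have "B i *v column k (A i) = axis k 1"
        using BAx[of i "axis k 1"] by (simp add: matrix_vector_mult_basis)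
      then show ?thesis
        using A(2)[OF that] unfolding Q'_def by (metis imageI)
    qed
    show "\<bar>x $ k\<bar> \<le> 1" if "x \<in> Q' i" "k \<in> K i" for i x k
      using that A(4)[of k i x] by (auto simp: Q'_def ABx)
  qed
  have linB: "linear ((*v) (B i))" for i
    by (rule matrix_vector_mul_linear)
  have Q'_body: "sym_convex_body (coord_space (K i)) (Q' i)" for i
  proof (rule sym_convex_bodyI[OF subspace_coord_space])
    show "Q' i \<subseteq> coord_space (K i)"
      using B_mem sym_convex_bodyD(1)[OF Q] by (auto simp: Q'_def)
    show "compact (Q' i)"
      unfolding Q'_def using linB sym_convex_bodyD(2)[OF Q]
      by (intro compact_continuous_image linear_continuous_on) (auto simp: linear_conv_bounded_linear)
    show conv: "convex (Q' i)"
      unfolding Q'_def using linB sym_convex_bodyD(4)[OF Q] by (rule convex_linear_image)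
    show sym: "- x \<in> Q' i" if "x \<in> Q' i" for x
      using that linear_image_sym[OF linB sym_convex_bodyD(5)[OF Q]] unfolding Q'_def by blast
    show "cball 0 (1 / CARD('n)) \<inter> coord_space (K i) \<subseteq> Q' i"
      using norm K by (intro cross_polytope_ball conv sym) (auto simp: normalised_def)
  qed simp
  have conv: "convex (T ` P)"
    using GL_tensorD(1)[OF T] sym_convex_bodyD(4)[OF Pb] by (rule convex_linear_image)
  have proj: "proj_tensor Q' \<subseteq> T ` P"
    unfolding proj_tensor_subset_iff[OF conv]
  proof (intro allI impI)
    fix x assume "\<forall>i. x i \<in> Q' i"
    then have "\<forall>i. \<exists>q\<in>Q i. x i = B i *v q"
      by (auto simp: Q'_def)
    then obtain q where q: "\<And>i. q i \<in> Q i" "\<And>i. x i = B i *v q i"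
      by metis
    have "elem_tensor x = T (elem_tensor q)"
      unfolding T_def tensor_map_elem_tensor by (simp flip: q(2))
    moreover have "elem_tensor q \<in> P"
      using sub(1) q(1) by (auto simp: proj_tensor_subset_iff[OF sym_convex_bodyD(4)[OF Pb]])
    ultimately show "elem_tensor x \<in> T ` P" by simp
  qed
  have TV: "T ` P \<subseteq> tensor_space K"
    using sym_convex_bodyD(1)[OF Pb] GL_tensorD(3)[OF T] by blast
  have inj: "T ` P \<subseteq> inj_tensor K Q'"
  proof
    fix z assume "z \<in> T ` P"
    then obtain p where p: "p \<in> P" "z = T p" by auto
    have "\<bar>z \<bullet> elem_tensor y\<bar> \<le> 1" if y: "\<And>i. y i \<in> polar (coord_space (K i)) (Q' i)" for y
    proof -
      have "transpose (B i) *v y i \<in> polar (coord_space (K i)) (Q i)" for i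
      proof -
        have "x \<bullet> (transpose (B i) *v y i) = (B i *v x) \<bullet> y i" for x
          by (metis dot_lmul_matrix inner_commute transpose_matrix_vector)
        then show ?thesis
          using y[of i] BT_mem by (auto simp: polar_def Q'_def)
      qed
      then show ?thesis
        using sub(2) p by (auto simp: T_def tensor_map_inner_elem_tensor mem_inj_tensor_iff)
    qed
    then show "z \<in> inj_tensor K Q'"
      using TV \<open>z \<in> T ` P\<close> by (auto simp: mem_inj_tensor_iff)
  qed
  have sym: "- x \<in> T ` P" if "x \<in> T ` P" for x
    using that linear_image_sym[OF GL_tensorD(1)[OF T] sym_convex_bodyD(5)[OF Pb]] by blast
  have "sym_convex_body (tensor_space K) (T ` P)"
  proof (rule sym_convex_bodyI[OF subspace_tensor_space TV _ conv sym])
    show "compact (T ` P)"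
      using GL_tensorD(1)[OF T] sym_convex_bodyD(2)[OF Pb]
      by (intro compact_continuous_image linear_continuous_on) (auto simp: linear_conv_bounded_linear)
    show "cball 0 (1 / CARD('l \<Rightarrow> 'n)) \<inter> tensor_space K \<subseteq> T ` P"
      unfolding tensor_space_def using K
      by (intro cross_polytope_ball conv sym normalised_elem_tensor(1)[OF conv proj inj norm]) (auto simp: Pi_eq_empty)
  qed auto
  then have "tensorial_pair K (T ` P) Q'"
    using Q'_body proj inj by (simp add: tensorial_pair_def)
  then show ?thesis
    using that T norm by blast
qed

section \<open>Selection of limits of tensorial bodies\<close>

lemma closed_scale_limit:
  fixes z :: "'a::real_normed_vector"
  assumes "closed P" "\<And>e. 0 < e \<Longrightarrow> inverse ((1 + e) ^ m) *\<^sub>R z \<in> P"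
  shows "z \<in> P"
proof (rule Lim_in_closed_set[OF assms(1)])
  show "((\<lambda>e. inverse ((1 + e) ^ m) *\<^sub>R z) \<longlongrightarrow> z) (at_right 0)"
    by (rule tendsto_eq_intros refl | simp)+
  show "\<forall>\<^sub>F e in at_right 0. inverse ((1 + e) ^ m) *\<^sub>R z \<in> P"
    by (rule eventually_mono[OF eventually_at_right_less]) (rule assms(2))
qed simp

text \<open>An elementary tensor of factors scaled by \<open>1 / (1 + e)\<close> is scaled by \<open>1 / (1 + e) ^ l\<close>. One more
  factor comes from comparing \<open>P\<close> with \<open>P'\<close>, so the inclusions hold up to \<open>(1 + e) ^ (l + 1)\<close>, which
  tends to \<open>1\<close>.\<close>

lemma tensorial_pair_limit:
  fixes K :: "'l::finite \<Rightarrow> 'n::finite set"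
  assumes P: "sym_convex_body (tensor_space K) P" and Q: "\<And>i. sym_convex_body (coord_space (K i)) (Q i)"
    and approx: "\<And>e. 0 < e \<Longrightarrow> \<exists>P' Q'. tensorial_pair K P' Q' \<and>
      P \<subseteq> (*\<^sub>R) (1 + e) ` P' \<and> P' \<subseteq> (*\<^sub>R) (1 + e) ` P \<and>
      (\<forall>i. Q' i \<subseteq> (*\<^sub>R) (1 + e) ` Q i \<and> Q i \<subseteq> (*\<^sub>R) (1 + e) ` Q' i)"
  shows "tensorial_pair K P Q"
proof -
  let ?m = "CARD('l) + 1"
  have "elem_tensor x \<in> P" if x: "\<And>i. x i \<in> Q i" for x
  proof (rule closed_scale_limit[OF sym_convex_bodyD(3)[OF P], of ?m])
    fix e :: real assume e: "0 < e"
    obtain P' Q' where PQ: "tensorial_pair K P' Q'" "P' \<subseteq> (*\<^sub>R) (1 + e) ` P"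
      "\<And>i. Q i \<subseteq> (*\<^sub>R) (1 + e) ` Q' i"
      using approx[OF e] by auto
    have conv: "convex P'"
      using PQ(1) sym_convex_bodyD(4) by (auto simp: tensorial_pair_def)
    have "inverse (1 + e) *\<^sub>R x i \<in> Q' i" for i
      using x[of i] PQ(3)[of i] e by (auto simp: mem_scaleR_image_iff)
    then have "elem_tensor (\<lambda>i. inverse (1 + e) *\<^sub>R x i) \<in> P'"
      using PQ(1) by (auto simp: tensorial_pair_def proj_tensor_subset_iff[OF conv])
    then have "inverse (1 + e) *\<^sub>R (inverse (1 + e) ^ CARD('l) *\<^sub>R elem_tensor x) \<in> P"
      unfolding elem_tensor_scale using PQ(2) e by (subst mem_scaleR_image_iff[symmetric]) auto
    then show "inverse ((1 + e) ^ ?m) *\<^sub>R elem_tensor x \<in> P"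
      by (simp add: power_inverse)
  qed
  then have "proj_tensor Q \<subseteq> P"
    by (simp add: proj_tensor_subset_iff[OF sym_convex_bodyD(4)[OF P]])
  moreover have "P \<subseteq> inj_tensor K Q"
  proof
    fix z assume z: "z \<in> P"
    have "\<bar>z \<bullet> elem_tensor y\<bar> \<le> 1" if y: "\<And>i. y i \<in> polar (coord_space (K i)) (Q i)" for y
    proof -
      have "z \<bullet> elem_tensor y \<in> {-1..1}"
      proof (rule closed_scale_limit[of _ ?m])
        fix e :: real assume e: "0 < e"
        obtain P' Q' where PQ: "tensorial_pair K P' Q'" "P \<subseteq> (*\<^sub>R) (1 + e) ` P'"
          "\<And>i. Q' i \<subseteq> (*\<^sub>R) (1 + e) ` Q i"
          using approx[OF e] by auto
        have "inverse (1 + e) *\<^sub>R y i \<in> polar (coord_space (K i)) (Q' i)" for i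
        proof -
          have "\<bar>x \<bullet> (inverse (1 + e) *\<^sub>R y i)\<bar> \<le> 1" if "x \<in> Q' i" for x
          proof -
            have "inverse (1 + e) *\<^sub>R x \<in> Q i"
              using PQ(3)[of i] that e by (auto simp: mem_scaleR_image_iff)
            then have "\<bar>(inverse (1 + e) *\<^sub>R x) \<bullet> y i\<bar> \<le> 1"
              using y[of i] unfolding polar_def by blast
            then show ?thesis by simp
          qed
          then show ?thesis
            using y[of i] by (auto simp: polar_def intro: subspace_mul[OF subspace_coord_space])
        qed
        moreover have "inverse (1 + e) *\<^sub>R z \<in> P'"
          using PQ(2) z e by (auto simp: mem_scaleR_image_iff)
        then have "inverse (1 + e) *\<^sub>R z \<in> inj_tensor K Q'"
          using PQ(1) by (auto simp: tensorial_pair_def)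
        ultimately have "\<bar>(inverse (1 + e) *\<^sub>R z) \<bullet> elem_tensor (\<lambda>i. inverse (1 + e) *\<^sub>R y i)\<bar> \<le> 1"
          by (auto simp: mem_inj_tensor_iff)
        also have "(inverse (1 + e) *\<^sub>R z) \<bullet> elem_tensor (\<lambda>i. inverse (1 + e) *\<^sub>R y i) =
            inverse ((1 + e) ^ ?m) *\<^sub>R (z \<bullet> elem_tensor y)"
          unfolding elem_tensor_scale by (simp add: power_inverse)
        finally show "inverse ((1 + e) ^ ?m) *\<^sub>R (z \<bullet> elem_tensor y) \<in> {-1..1}"
          by auto
      qed simp
      then show ?thesis by auto
    qed
    then show "z \<in> inj_tensor K Q"
      using z sym_convex_bodyD(1)[OF P] by (auto simp: mem_inj_tensor_iff)
  qed
  ultimately show ?thesis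
    using P Q by (simp add: tensorial_pair_def)
qed

lemma tensor_BM_dist_mutual:
  assumes P: "P \<in> tensorial_bodies K" and Q: "Q \<in> tensorial_bodies K" and e: "0 < e"
    and sub: "P \<subseteq> (*\<^sub>R) (1 + e) ` Q" "Q \<subseteq> (*\<^sub>R) (1 + e) ` P"
  shows "tensor_BM_dist K P Q \<le> (1 + e)\<^sup>2"
proof (rule tensor_BM_dist_le)
  show "(\<lambda>z. (1 + e) *\<^sub>R z) \<in> GL_tensor K"
    using e by (intro GL_tensor_scale GL_tensor_id) auto
  show "(\<lambda>z. (1 + e) *\<^sub>R z) ` P \<subseteq> (*\<^sub>R) ((1 + e)\<^sup>2) ` Q"
  proof
    fix z assume "z \<in> (\<lambda>z. (1 + e) *\<^sub>R z) ` P"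
    then obtain q where "q \<in> Q" "z = (1 + e) *\<^sub>R (1 + e) *\<^sub>R q"
      using sub(1) by blast
    then show "z \<in> (*\<^sub>R) ((1 + e)\<^sup>2) ` Q"
      by (auto simp: power2_eq_square)
  qed
  show "1 \<le> (1 + e)\<^sup>2"
    using e by (intro one_le_power) simp
qed (rule sub(2))

text \<open>The normalised images of \<open>P n\<close> have distance \<open>1\<close> from \<open>P n\<close>, so it is enough to find a limit
  for them. The factors are made to converge first, then the bodies along a further subsequence.\<close>

theorem tensorial_selection:
  fixes K :: "'l::finite \<Rightarrow> 'n::finite set"
  assumes K: "\<And>i. K i \<noteq> {}" and P: "\<And>n. P n \<in> tensorial_bodies K"
  obtains L k where "L \<in> tensorial_bodies K" "strict_mono (k :: nat \<Rightarrow> nat)"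
    "(\<lambda>n. tensor_BM_dist K (P (k n)) L) \<longlonglongrightarrow> 1"
proof -
  have "\<exists>T Q. T \<in> GL_tensor K \<and> tensorial_pair K (T ` P n) Q \<and> normalised K Q" for n
    using normalisation[OF K P[of n]] by metis
  then obtain T Q where T: "\<And>n. T n \<in> GL_tensor K" and PQ: "\<And>n. tensorial_pair K (T n ` P n) (Q n)"
    and norm: "\<And>n. normalised K (Q n)"
    by metis
  define P' where "P' n = T n ` P n" for n
  have P': "P' n \<in> tensorial_bodies K" for n
    using PQ by (auto simp: tensorial_bodies_iff P'_def)
  have Q_body: "sym_convex_body (coord_space (K i)) (Q n i)" for n i
    using PQ[of n] by (simp add: tensorial_pair_def)
  have pos: "0 < 1 / real CARD('n)" "0 < 1 / real CARD('l \<Rightarrow> 'n)"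
    by simp_all
  note bounds = normalised_bounds[OF K PQ norm]
  obtain k1 Q\<^sub>L where k1: "strict_mono (k1 :: nat \<Rightarrow> nat)" "\<forall>i. sym_convex_body (coord_space (K i)) (Q\<^sub>L i)"
    and Q: "\<forall>e>0. \<forall>\<^sub>F n in sequentially. \<forall>i.
       Q (k1 n) i \<subseteq> (*\<^sub>R) (1 + e) ` Q\<^sub>L i \<and> Q\<^sub>L i \<subseteq> (*\<^sub>R) (1 + e) ` Q (k1 n) i"
    using body_family_selection[of "\<lambda>i. coord_space (K i)" Q "1 / CARD('n)" "CARD('n)",
        OF subspace_coord_space Q_body pos(1) bounds(1,2)] .
  \<comment> \<open>A single body is a family indexed by \<^typ>\<open>unit\<close>.\<close>
  obtain k2 L where k2: "strict_mono (k2 :: nat \<Rightarrow> nat)" "\<forall>i::unit. sym_convex_body (tensor_space K) (L i)"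
    and L: "\<forall>e>0. \<forall>\<^sub>F n in sequentially. \<forall>i.
       P' (k1 (k2 n)) \<subseteq> (*\<^sub>R) (1 + e) ` L i \<and> L i \<subseteq> (*\<^sub>R) (1 + e) ` P' (k1 (k2 n))"
    using body_family_selection[of "\<lambda>i::unit. tensor_space K" "\<lambda>n i. P' (k1 n)"
        "1 / CARD('l \<Rightarrow> 'n)" "CARD('l \<Rightarrow> 'n)",
        OF subspace_tensor_space tensorial_body_body[OF P'] pos(2) bounds(3,4)[folded P'_def]] .
  define k where "k = k1 \<circ> k2"
  have both: "\<forall>\<^sub>F n in sequentially. P' (k n) \<subseteq> (*\<^sub>R) (1 + e) ` L () \<and> L () \<subseteq> (*\<^sub>R) (1 + e) ` P' (k n) \<and>
     (\<forall>i. Q (k n) i \<subseteq> (*\<^sub>R) (1 + e) ` Q\<^sub>L i \<and> Q\<^sub>L i \<subseteq> (*\<^sub>R) (1 + e) ` Q (k n) i)" if "0 < e" for e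
    using L[rule_format, OF that] eventually_subseq[OF k2(1) Q[rule_format, OF that]] by eventually_elim (simp add: k_def)
  have "tensorial_pair K (L ()) Q\<^sub>L"
  proof (rule tensorial_pair_limit[OF k2(2)[rule_format] k1(2)[rule_format]])
    fix e :: real assume "0 < e"
    from eventually_happens[OF both[OF this]] obtain n where
      "P' (k n) \<subseteq> (*\<^sub>R) (1 + e) ` L ()" "L () \<subseteq> (*\<^sub>R) (1 + e) ` P' (k n)"
      "\<forall>i. Q (k n) i \<subseteq> (*\<^sub>R) (1 + e) ` Q\<^sub>L i \<and> Q\<^sub>L i \<subseteq> (*\<^sub>R) (1 + e) ` Q (k n) i"
      by auto
    then show "\<exists>P' Q'. tensorial_pair K P' Q' \<and>
      L () \<subseteq> (*\<^sub>R) (1 + e) ` P' \<and> P' \<subseteq> (*\<^sub>R) (1 + e) ` L () \<and>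
      (\<forall>i. Q' i \<subseteq> (*\<^sub>R) (1 + e) ` Q\<^sub>L i \<and> Q\<^sub>L i \<subseteq> (*\<^sub>R) (1 + e) ` Q' i)"
      using PQ[of "k n"] by (intro exI[of _ "P' (k n)"] exI[of _ "Q (k n)"]) (simp add: P'_def)
  qed
  then have L_body: "L () \<in> tensorial_bodies K"
    by (auto simp: tensorial_bodies_iff)
  have dist_P': "tensor_BM_dist K (P n) (P' n) \<le> 1" for n
    by (rule tensor_BM_dist_le[OF _ T[of n]]) (auto simp: P'_def)
  have lim: "(\<lambda>n. tensor_BM_dist K (P (k n)) (L ())) \<longlonglongrightarrow> 1"
  proof (rule tendstoI)
    fix e :: real assume "0 < e"
    \<comment> \<open>\<open>(1 + \<eta>)\<^sup>2 \<le> 1 + 3 \<eta> < 1 + e\<close> for \<open>\<eta> \<le> 1\<close>.\<close>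
    define \<eta> where "\<eta> = min 1 (e / 4)"
    have \<eta>: "0 < \<eta>" "\<eta> \<le> 1" "3 * \<eta> < e"
      using \<open>0 < e\<close> by (auto simp: \<eta>_def min_def)
    show "\<forall>\<^sub>F n in sequentially. dist (tensor_BM_dist K (P (k n)) (L ())) 1 < e"
      using both[OF \<eta>(1)]
    proof eventually_elim
      case (elim n)
      have "tensor_BM_dist K (P (k n)) (L ()) \<le> tensor_BM_dist K (P (k n)) (P' (k n)) * tensor_BM_dist K (P' (k n)) (L ())"
        by (intro tensor_BM_dist_triangle P P' L_body)
      also have "\<dots> \<le> 1 * (1 + \<eta>)\<^sup>2"
        using elim \<eta>(1) tensor_BM_dist_ge_1[OF P' L_body]
        by (intro mult_mono dist_P' tensor_BM_dist_mutual P' L_body) (auto intro: order_trans[OF zero_le_one])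
      also have "\<dots> \<le> 1 + 3 * \<eta>"
        using \<eta> mult_left_mono[of \<eta> 1 \<eta>] by (simp add: power2_eq_square algebra_simps)
      finally show ?case
        using tensor_BM_dist_ge_1[OF P L_body, of "k n"] \<eta> by (simp add: dist_real_def)
    qed
  qed
  show ?thesis
    by (rule that[OF L_body _ lim]) (simp add: k_def k1(1) k2(1) strict_mono_compose)
qed

section \<open>The compact metric space of classes\<close>

lemma equiv_tensor_BM_rel: "equiv (tensorial_bodies K) (tensor_BM_rel K)"
proof (rule equivI)
  show "tensor_BM_rel K \<subseteq> tensorial_bodies K \<times> tensorial_bodies K"
    by (auto simp: tensor_BM_rel_def)
  show "refl_on (tensorial_bodies K) (tensor_BM_rel K)"
    by (auto simp: refl_on_def tensor_BM_rel_def tensor_BM_dist_refl)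
  show "sym (tensor_BM_rel K)"
    by (auto simp: sym_def tensor_BM_rel_def tensor_BM_dist_sym)
  show "trans (tensor_BM_rel K)"
  proof (rule transI)
    fix P Q R assume "(P, Q) \<in> tensor_BM_rel K" "(Q, R) \<in> tensor_BM_rel K"
    then show "(P, R) \<in> tensor_BM_rel K"
      using tensor_BM_dist_triangle[of P K Q R] tensor_BM_dist_ge_1[of P K R]
      by (auto simp: tensor_BM_rel_def)
  qed
qed

text \<open>Distance \<open>1\<close> contributes the factor \<open>1\<close> to the triangle inequality.\<close>

lemma tensor_BM_dist_cong:
  assumes P: "(P, P') \<in> tensor_BM_rel K" and Q: "(Q, Q') \<in> tensor_BM_rel K"
  shows "tensor_BM_dist K P Q = tensor_BM_dist K P' Q'"
proof -
  have *: "tensor_BM_dist K P Q \<le> tensor_BM_dist K P' Q'"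
    if P: "(P, P') \<in> tensor_BM_rel K" and Q: "(Q, Q') \<in> tensor_BM_rel K" for P P' Q Q'
  proof -
    have "tensor_BM_dist K P Q \<le> tensor_BM_dist K P P' * tensor_BM_dist K P' Q"
      using P Q by (intro tensor_BM_dist_triangle) (auto simp: tensor_BM_rel_def)
    moreover have "tensor_BM_dist K P' Q \<le> tensor_BM_dist K P' Q' * tensor_BM_dist K Q' Q"
      using P Q by (intro tensor_BM_dist_triangle) (auto simp: tensor_BM_rel_def)
    ultimately show ?thesis
      using P Q tensor_BM_dist_sym[of Q K Q'] by (auto simp: tensor_BM_rel_def)
  qed
  have "(P', P) \<in> tensor_BM_rel K" "(Q', Q) \<in> tensor_BM_rel K"
    using P Q equiv_tensor_BM_rel by (meson equivE symE)+
  then show ?thesis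
    using *[OF P Q] *[of P' P Q' Q] by simp
qed

lemma log_tensor_BM_dist_eq:
  assumes X: "X \<in> tensor_BM K" "P \<in> X" and Y: "Y \<in> tensor_BM K" "Q \<in> Y"
  shows "log_tensor_BM_dist K X Y = ln (tensor_BM_dist K P Q)"
proof -
  have eq: "tensor_BM_dist K P' Q' = tensor_BM_dist K P Q" if "P' \<in> X" "Q' \<in> Y" for P' Q'
    using quotient_eq_iff[OF equiv_tensor_BM_rel, of X K X P' P]
      quotient_eq_iff[OF equiv_tensor_BM_rel, of Y K Y Q' Q] X Y that
    by (intro tensor_BM_dist_cong) (simp_all add: tensor_BM_def)
  have "(THE r. \<forall>P\<in>X. \<forall>Q\<in>Y. r = ln (tensor_BM_dist K P Q)) = ln (tensor_BM_dist K P Q)"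
  proof (rule the_equality)
    show "\<forall>P'\<in>X. \<forall>Q'\<in>Y. ln (tensor_BM_dist K P Q) = ln (tensor_BM_dist K P' Q')"
      using eq by metis
    show "r = ln (tensor_BM_dist K P Q)" if "\<forall>P\<in>X. \<forall>Q\<in>Y. r = ln (tensor_BM_dist K P Q)" for r
      using that X(2) Y(2) by blast
  qed
  then show ?thesis
    using X Y by (simp add: log_tensor_BM_dist_def)
qed

lemma tensor_BM_representative:
  assumes "X \<in> tensor_BM K"
  obtains P where "P \<in> X" "P \<in> tensorial_bodies K"
proof -
  have "X \<noteq> {}" "X \<subseteq> tensorial_bodies K"
    using in_quotient_imp_non_empty[OF equiv_tensor_BM_rel] in_quotient_imp_subset[OF equiv_tensor_BM_rel]
      assms[unfolded tensor_BM_def] by blast+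
  then show ?thesis
    using that by auto
qed

theorem Metric_space_tensor_BM: "Metric_space (tensor_BM K) (log_tensor_BM_dist K)"
proof
  show "0 \<le> log_tensor_BM_dist K X Y" for X Y
  proof (cases "X \<in> tensor_BM K \<and> Y \<in> tensor_BM K")
    case True
    then obtain P Q where "P \<in> X" "P \<in> tensorial_bodies K" "Q \<in> Y" "Q \<in> tensorial_bodies K"
      by (meson tensor_BM_representative)
    then show ?thesis
      using True tensor_BM_dist_ge_1[of P K Q] by (simp add: log_tensor_BM_dist_eq)
  qed (auto simp: log_tensor_BM_dist_def)
  show "log_tensor_BM_dist K X Y = log_tensor_BM_dist K Y X" for X Y
  proof (cases "X \<in> tensor_BM K \<and> Y \<in> tensor_BM K")
    case True
    then obtain P Q where "P \<in> X" "P \<in> tensorial_bodies K" "Q \<in> Y" "Q \<in> tensorial_bodies K"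
      by (meson tensor_BM_representative)
    then show ?thesis
      using True tensor_BM_dist_sym[of P K Q]
        log_tensor_BM_dist_eq[of X K P Y Q] log_tensor_BM_dist_eq[of Y K Q X P] by simp
  qed (auto simp: log_tensor_BM_dist_def)
  show "log_tensor_BM_dist K X Y = 0 \<longleftrightarrow> X = Y" if X: "X \<in> tensor_BM K" and Y: "Y \<in> tensor_BM K" for X Y
  proof -
    obtain P where P: "P \<in> X" "P \<in> tensorial_bodies K" using tensor_BM_representative[OF X] .
    obtain Q where Q: "Q \<in> Y" "Q \<in> tensorial_bodies K" using tensor_BM_representative[OF Y] .
    have "log_tensor_BM_dist K X Y = 0 \<longleftrightarrow> tensor_BM_dist K P Q = 1"
      using tensor_BM_dist_ge_1[OF P(2) Q(2)] by (simp add: log_tensor_BM_dist_eq[OF X P(1) Y Q(1)])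
    also have "\<dots> \<longleftrightarrow> (P, Q) \<in> tensor_BM_rel K"
      using P Q by (simp add: tensor_BM_rel_def)
    also have "\<dots> \<longleftrightarrow> X = Y"
      using quotient_eq_iff[OF equiv_tensor_BM_rel X[unfolded tensor_BM_def] Y[unfolded tensor_BM_def] P(1) Q(1)] by simp
    finally show ?thesis .
  qed
  show "log_tensor_BM_dist K X Z \<le> log_tensor_BM_dist K X Y + log_tensor_BM_dist K Y Z"
    if X: "X \<in> tensor_BM K" and Y: "Y \<in> tensor_BM K" and Z: "Z \<in> tensor_BM K" for X Y Z
  proof -
    obtain P where P: "P \<in> X" "P \<in> tensorial_bodies K" using tensor_BM_representative[OF X] .
    obtain Q where Q: "Q \<in> Y" "Q \<in> tensorial_bodies K" using tensor_BM_representative[OF Y] .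
    obtain R where R: "R \<in> Z" "R \<in> tensorial_bodies K" using tensor_BM_representative[OF Z] .
    have "1 \<le> tensor_BM_dist K P Q" "1 \<le> tensor_BM_dist K Q R" "1 \<le> tensor_BM_dist K P R"
      using P Q R by (auto intro: tensor_BM_dist_ge_1)
    then have "ln (tensor_BM_dist K P R) \<le> ln (tensor_BM_dist K P Q) + ln (tensor_BM_dist K Q R)"
      using tensor_BM_dist_triangle[OF P(2) Q(2) R(2)] by (simp flip: ln_mult_pos)
    then show ?thesis
      using P Q R X Y Z by (simp add: log_tensor_BM_dist_eq)
  qed
qed

theorem compact_space_tensor_BM:
  fixes K :: "'l::finite \<Rightarrow> 'n::finite set"
  assumes K: "\<And>i. K i \<noteq> {}"
  shows "compact_space (Metric_space.mtopology (tensor_BM K) (log_tensor_BM_dist K))"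
proof -
  show ?thesis
    unfolding Metric_space.compact_space_sequentially[OF Metric_space_tensor_BM]
  proof (intro allI impI)
    fix X :: "nat \<Rightarrow> (real ^ ('l \<Rightarrow> 'n)) set set" assume "range X \<subseteq> tensor_BM K"
    then have X: "X n \<in> tensor_BM K" for n
      by (simp add: image_subset_iff)
    have "\<forall>n. \<exists>P. P \<in> X n \<and> P \<in> tensorial_bodies K"
      using tensor_BM_representative[OF X] by metis
    then obtain P where P: "\<And>n. P n \<in> X n" "\<And>n. P n \<in> tensorial_bodies K"
      by metis
    obtain L k where L: "L \<in> tensorial_bodies K" and k: "strict_mono (k :: nat \<Rightarrow> nat)"
      and lim: "(\<lambda>n. tensor_BM_dist K (P (k n)) L) \<longlonglongrightarrow> 1"
      using tensorial_selection[OF K P(2)] .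
    let ?Y = "tensor_BM_rel K `` {L}"
    have Y: "?Y \<in> tensor_BM K" "L \<in> ?Y"
      using L equiv_class_self[OF equiv_tensor_BM_rel] by (auto simp: tensor_BM_def quotientI)
    have "(\<lambda>n. ln (tensor_BM_dist K (P (k n)) L)) \<longlonglongrightarrow> ln 1"
      using lim by (rule tendsto_ln) simp
    then have "(\<lambda>n. log_tensor_BM_dist K (X (k n)) ?Y) \<longlonglongrightarrow> 0"
      using log_tensor_BM_dist_eq[OF X P(1) Y] by simp
    then have "limitin (Metric_space.mtopology (tensor_BM K) (log_tensor_BM_dist K)) (X \<circ> k) ?Y sequentially"
      using X Y by (simp add: Metric_space.limitin_metric_dist_null[OF Metric_space_tensor_BM])
    then show "\<exists>l r. l \<in> tensor_BM K \<and> strict_mono r \<and> limitin (Metric_space.mtopology (tensor_BM K) (log_tensor_BM_dist K)) (X \<circ> r) l sequentially"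
      using Y k by blast
  qed
qed

theorem theorem3p13:
  fixes K :: "'l::finite \<Rightarrow> 'n::finite set" and d :: "'l \<Rightarrow> nat"
  assumes "\<And>i. card (K i) = d i" and "\<And>i. d i \<ge> 2"
  shows "Metric_space (tensor_BM K) (log_tensor_BM_dist K) \<and>
    compact_space (Metric_space.mtopology (tensor_BM K) (log_tensor_BM_dist K))"
proof -
  have "K i \<noteq> {}" for i
    using assms[of i] by auto
  then show ?thesis
    using Metric_space_tensor_BM compact_space_tensor_BM by blast
qed

end
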